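(* Let $\mathcal{H}$ be a complex Hilbert space with a countable orthonormal basis, let $A$ be a bounded linear operator on $\mathcal{H}$, and let $I$ be the identity operator on $\mathcal{H}$. Then: (a) $\sigma(A\odot I)=\frac{1}{2}(\sigma(A)+\sigma(A))$, that is, $\sigma(A\odot I)=\{\frac{1}{2}(\lambda+\mu):\lambda,\mu\in\sigma(A)\}$. (b) $\sigma(A\odot A)=\sigma(A)\sigma(A)$, that is, $\sigma(A\odot A)=\{\lambda\mu:\lambda,\mu\in\sigma(A)\}$.
   Context: $\sigma(T)$ denotes the spectrum of a bounded operator $T$. Let $\mathcal{H}\otimes\mathcal{H}$ be the Hilbert-space tensor product and let $\hat\pi$ be the unitary flip on it, determined by $\hat\pi(\vec{u}\otimes\vec{v})=\vec{v}\otimes\vec{u}$. The symmetric tensor power is the closed subspace $\mathcal{H}\odot\mathcal{H}=\{\vec{x}\in\mathcal{H}\otimes\mathcal{H}:\hat\pi\vec{x}=\vec{x}\}$. For bounded operators $A,B$ on $\mathcal{H}$, $A\otimes B$ is the bounded operator on $\mathcal{H}\otimes\mathcal{H}$ with $(A\otimes B)(\vec{u}\otimes\vec{v})=A\vec{u}\otimes B\vec{v}$, and the symmetric tensor product $A\odot B$ is the restriction of $\frac{1}{2}(A\otimes B+B\otimes A)$ to $\mathcal{H}\odot\mathcal{H}$, which is invariant under it, regarded as an operator on $\mathcal{H}\odot\mathcal{H}$. *)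

theory Defs
  imports "HOL-Analysis.Analysis"
begin

class complex_vector = real_vector +
  fixes scaleC :: "complex \<Rightarrow> 'a \<Rightarrow> 'a" (infixr "*\<^sub>C" 75)
  assumes scaleC_add_right: "a *\<^sub>C (x + y) = a *\<^sub>C x + a *\<^sub>C y"
    and scaleC_add_left: "(a + b) *\<^sub>C x = a *\<^sub>C x + b *\<^sub>C x"
    and scaleC_scaleC: "a *\<^sub>C (b *\<^sub>C x) = (a * b) *\<^sub>C x"
    and scaleC_one: "1 *\<^sub>C x = x"
    and scaleR_scaleC: "r *\<^sub>R x = complex_of_real r *\<^sub>C x"

global_interpretation complex_vector: vector_space "scaleC :: complex \<Rightarrow> 'a \<Rightarrow> 'a::complex_vector"
  defines cspan = complex_vector.span
  by unfold_locales (rule scaleC_add_right scaleC_add_left scaleC_scaleC scaleC_one)+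

(* The inner product is conjugate-linear in its first argument. *)
class chilbert_space = complex_vector + banach +
  fixes cinner :: "'a \<Rightarrow> 'a \<Rightarrow> complex"
  assumes cinner_commute: "cinner x y = cnj (cinner y x)"
    and cinner_add_right: "cinner x (y + z) = cinner x y + cinner x z"
    and cinner_scaleC_right: "cinner x (c *\<^sub>C y) = c * cinner x y"
    and cinner_self: "cinner x x = complex_of_real ((norm x)\<^sup>2)"

definition orthonormal_basis :: "'a::chilbert_space set \<Rightarrow> bool" where
  "orthonormal_basis B \<longleftrightarrow>
     (\<forall>x\<in>B. \<forall>y\<in>B. cinner x y = (if x = y then 1 else 0)) \<and> closure (cspan B) = UNIV"

definition bounded_clinear_on :: "'a::chilbert_space set \<Rightarrow> ('a \<Rightarrow> 'a) \<Rightarrow> bool" where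
  "bounded_clinear_on S T \<longleftrightarrow>
     (\<forall>x\<in>S. T x \<in> S) \<and>
     (\<forall>x\<in>S. \<forall>y\<in>S. T (x + y) = T x + T y) \<and>
     (\<forall>c. \<forall>x\<in>S. T (c *\<^sub>C x) = c *\<^sub>C T x) \<and>
     (\<exists>K. \<forall>x\<in>S. norm (T x) \<le> K * norm x)"

abbreviation bounded_clinear :: "('a::chilbert_space \<Rightarrow> 'a) \<Rightarrow> bool" where
  "bounded_clinear \<equiv> bounded_clinear_on UNIV"

(* The spectrum of T as an operator on the closed subspace S; only the values of T on S matter. *)
definition spectrum_on :: "'a::chilbert_space set \<Rightarrow> ('a \<Rightarrow> 'a) \<Rightarrow> complex set" where
  "spectrum_on S T =
     {z. \<not> (\<exists>R. bounded_clinear_on S R \<and>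
              (\<forall>x\<in>S. R (T x - z *\<^sub>C x) = x \<and> T (R x) - z *\<^sub>C R x = x))}"

abbreviation spectrum :: "('a::chilbert_space \<Rightarrow> 'a) \<Rightarrow> complex set" where
  "spectrum \<equiv> spectrum_on UNIV"

(* A Hilbert-space tensor product of 'h with itself, which these conditions determine up to a
   unique unitary compatible with the elementary tensors: 'k carries the tensor product, and
   tensor u v is the elementary tensor of u and v. *)
definition hilbert_tensor_product ::
    "('h::chilbert_space \<Rightarrow> 'h \<Rightarrow> 'k::chilbert_space) \<Rightarrow> bool" where
  "hilbert_tensor_product tensor \<longleftrightarrow>
     (\<forall>u u' v. tensor (u + u') v = tensor u v + tensor u' v) \<and>
     (\<forall>u v v'. tensor u (v + v') = tensor u v + tensor u v') \<and>
     (\<forall>c u v. tensor (c *\<^sub>C u) v = c *\<^sub>C tensor u v) \<and>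
     (\<forall>c u v. tensor u (c *\<^sub>C v) = c *\<^sub>C tensor u v) \<and>
     (\<forall>u v u' v'. cinner (tensor u v) (tensor u' v') = cinner u u' * cinner v v') \<and>
     closure (cspan {tensor u v |u v. True}) = UNIV"

(* For a Hilbert tensor product the two descriptions below are each satisfied by exactly one
   operator (uniqueness by density of the span of the elementary tensors). *)
definition tensor_op ::
    "('h::chilbert_space \<Rightarrow> 'h \<Rightarrow> 'k::chilbert_space) \<Rightarrow> ('h \<Rightarrow> 'h) \<Rightarrow> ('h \<Rightarrow> 'h) \<Rightarrow> 'k \<Rightarrow> 'k" where
  "tensor_op tensor A B =
     (THE T. bounded_clinear T \<and> (\<forall>u v. T (tensor u v) = tensor (A u) (B v)))"

definition tensor_flip ::
    "('h::chilbert_space \<Rightarrow> 'h \<Rightarrow> 'k::chilbert_space) \<Rightarrow> 'k \<Rightarrow> 'k" where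
  "tensor_flip tensor =
     (THE F. bounded_clinear F \<and> (\<forall>u v. F (tensor u v) = tensor v u))"

definition sym_tensor_space ::
    "('h::chilbert_space \<Rightarrow> 'h \<Rightarrow> 'k::chilbert_space) \<Rightarrow> 'k set" where
  "sym_tensor_space tensor = {x. tensor_flip tensor x = x}"

definition sym_tensor_op ::
    "('h::chilbert_space \<Rightarrow> 'h \<Rightarrow> 'k::chilbert_space) \<Rightarrow> ('h \<Rightarrow> 'h) \<Rightarrow> ('h \<Rightarrow> 'h) \<Rightarrow> 'k \<Rightarrow> 'k" where
  "sym_tensor_op tensor A B =
     (\<lambda>x\<in>sym_tensor_space tensor.
        (1/2) *\<^sub>C (tensor_op tensor A B x + tensor_op tensor B A x))"

end

theory Submission
  imports Defs "HOL-Complex_Analysis.Complex_Analysis"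
begin

text \<open>Spectral points are those at which \<open>T - l\<close> or its adjoint fails to be bounded below; on the boundary of
  the spectrum both fail. If \<open>l\<close> and \<open>m\<close> are of the same type, approximate eigenvectors \<open>u\<close>, \<open>v\<close> of \<open>A\<close> (or
  of its adjoint) yield the approximate eigenvector \<open>u \<otimes> v + v \<otimes> u\<close> in the symmetric subspace. For mixed
  types, move \<open>(l, m)\<close> along \<open>(l + t, m - t)\<close>, respectively \<open>(l e\<^sup>t, m e\<^sup>-\<^sup>t)\<close>, until one point reaches the
  boundary. Conversely, let \<open>a = A \<otimes> I\<close> and \<open>b = I \<otimes> A\<close>. If for every \<open>l\<close> one of \<open>a - l\<close> and \<open>c - l d\<close> is
  invertible, where \<open>a\<close>, \<open>c\<close>, \<open>d\<close> commute, then a Liouville argument shows that \<open>a d - c\<close> is invertible. The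
  choices \<open>(c, d) = (b - 2 z, -1)\<close> and \<open>(c, d) = (z, b)\<close> handle the sum and the product, and the inverse
  restricts to the symmetric subspace because it commutes with the flip.\<close>

section \<open>Operators on a complex Hilbert space\<close>

text \<open>Mixed types are a genuine obstacle: if \<open>l\<close> is witnessed only by approximate
  eigenvectors of \<open>A\<close> and \<open>m\<close> only by those of its adjoint, the tensor of
  the two witnesses need not be an approximate eigenvector of \<open>A \<otimes> A\<close> or of its
  adjoint. Both curves keep the relevant combination, \<open>l + m\<close> or \<open>l m\<close>,
  constant and drive the first point out of the bounded spectrum. At the first time when one of the
  two points is not interior, both still lie in the closed spectrum; that one has both types and so
  matches the other. Symmetrising is harmless, since \<open>u \<otimes> v\<close> and
  \<open>v \<otimes> u\<close> have the inner product \<open>|<u, v>|^2\<close>, which is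
  nonnegative, and cannot cancel.

  For the converse, the pencil \<open>c - l d\<close> treats both cases at once: it is
  \<open>b - (2 z - l)\<close>, respectively \<open>z - l b\<close>, while \<open>a d - c\<close> is
  \<open>-(a + b - 2 z)\<close>, respectively \<open>a b - z\<close>. The form
  \<open>z - l b\<close> stays meaningful at \<open>l = 0\<close>, where \<open>z / l\<close> does
  not.\<close>

lemma cinner_add_left: "cinner (x + y) z = cinner x z + cinner y z"
  for x y z :: "'a::chilbert_space"
  by (metis cinner_add_right cinner_commute complex_cnj_add)

lemma cinner_scaleC_left: "cinner (c *\<^sub>C x) y = cnj c * cinner x y"
  for x y :: "'a::chilbert_space"
  by (metis cinner_scaleC_right cinner_commute complex_cnj_mult)

lemma cinner_zero_right [simp]: "cinner x 0 = 0" for x :: "'a::chilbert_space"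
  by (metis cinner_scaleC_right complex_vector.scale_zero_left mult_zero_left)

lemma cinner_zero_left [simp]: "cinner 0 x = 0" for x :: "'a::chilbert_space"
  by (metis cinner_zero_right cinner_commute complex_cnj_zero)

lemma cinner_minus_right: "cinner x (- y) = - cinner x y" for x y :: "'a::chilbert_space"
  by (metis add_eq_0_iff cinner_add_right cinner_zero_right add.right_inverse)

lemma cinner_minus_left: "cinner (- x) y = - cinner x y" for x y :: "'a::chilbert_space"
  by (metis cinner_minus_right cinner_commute complex_cnj_minus)

lemma cinner_diff_right: "cinner x (y - z) = cinner x y - cinner x z" for x :: "'a::chilbert_space"
  by (metis cinner_add_right cinner_minus_right diff_conv_add_uminus)

lemma cinner_diff_left: "cinner (x - y) z = cinner x z - cinner y z" for x :: "'a::chilbert_space"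
  by (metis cinner_add_left cinner_minus_left diff_conv_add_uminus)

lemma cinner_sum_right: "cinner x (sum f I) = (\<Sum>i\<in>I. cinner x (f i))" for x :: "'a::chilbert_space"
  by (induction I rule: infinite_finite_induct) (auto simp: cinner_add_right)

lemma cinner_sum_left: "cinner (sum f I) x = (\<Sum>i\<in>I. cinner (f i) x)" for x :: "'a::chilbert_space"
  by (induction I rule: infinite_finite_induct) (auto simp: cinner_add_left)

lemma Re_cinner_self: "Re (cinner x x) = (norm x)\<^sup>2" for x :: "'a::chilbert_space"
  by (simp add: cinner_self)

lemma norm_scaleC: "norm (c *\<^sub>C x) = cmod c * norm x" for x :: "'a::chilbert_space"
proof -
  have "complex_of_real ((norm (c *\<^sub>C x))\<^sup>2) = cnj c * (c * cinner x x)"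
    by (simp only: cinner_self[symmetric] cinner_scaleC_left cinner_scaleC_right mult.left_commute)
  also have "\<dots> = complex_of_real ((cmod c * norm x)\<^sup>2)"
    by (simp add: cinner_self power_mult_distrib mult.assoc[symmetric] mult.commute[of "cnj c"]
        flip: complex_norm_square)
  finally have "(norm (c *\<^sub>C x))\<^sup>2 = (cmod c * norm x)\<^sup>2"
    using of_real_eq_iff by blast
  then show ?thesis
    by (metis norm_ge_zero mult_nonneg_nonneg power2_eq_iff_nonneg)
qed

lemma power2_norm_add: "(norm (x + y))\<^sup>2 = (norm x)\<^sup>2 + (norm y)\<^sup>2 + 2 * Re (cinner x y)"
  for x y :: "'a::chilbert_space"
proof -
  have "Re (cinner y x) = Re (cinner x y)"
    by (metis cinner_commute cnj.sel(1))
  then show ?thesis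
    by (simp add: Re_cinner_self[symmetric] cinner_add_left cinner_add_right)
qed

lemma power2_norm_diff: "(norm (x - y))\<^sup>2 = (norm x)\<^sup>2 + (norm y)\<^sup>2 - 2 * Re (cinner x y)"
  for x y :: "'a::chilbert_space"
  using power2_norm_add[of x "- y"] by (simp add: cinner_minus_right)

lemma cinner_cauchy_schwarz: "cmod (cinner x y) \<le> norm x * norm y" for x y :: "'a::chilbert_space"
proof (cases "y = 0")
  case False
  define \<alpha> \<beta> where "\<alpha> = (norm y)\<^sup>2" and "\<beta> = cinner y x"
  have \<beta>: "cinner x y = cnj \<beta>" unfolding \<beta>_def by (rule cinner_commute)
  have pos: "\<alpha> > 0" using False by (simp add: \<alpha>_def)
  \<comment> \<open>This vector is \<open>\<alpha>\<close> times the component of \<open>x\<close>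
    orthogonal to \<open>y\<close>; the factor \<open>\<alpha>\<close> avoids a division.\<close>
  have "0 \<le> (norm (complex_of_real \<alpha> *\<^sub>C x - \<beta> *\<^sub>C y))\<^sup>2" by simp
  also have "\<dots> = \<alpha>\<^sup>2 * (norm x)\<^sup>2 + (cmod \<beta>)\<^sup>2 * \<alpha> - 2 * Re (complex_of_real \<alpha> * (\<beta> * cnj \<beta>))"
    by (simp only: power2_norm_diff norm_scaleC cinner_scaleC_left cinner_scaleC_right \<beta>
        power_mult_distrib \<alpha>_def[symmetric] norm_of_real power2_abs complex_cnj_complex_of_real mult.left_commute)
  also have "\<dots> = \<alpha> * (\<alpha> * (norm x)\<^sup>2 - (cmod \<beta>)\<^sup>2)"
    by (simp add: complex_norm_square[symmetric] power2_eq_square algebra_simps flip: of_real_mult)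
  finally have "(cmod \<beta>)\<^sup>2 \<le> \<alpha> * (norm x)\<^sup>2"
    using pos by (simp add: zero_le_mult_iff)
  then have "(cmod \<beta>)\<^sup>2 \<le> (norm x * norm y)\<^sup>2"
    by (simp add: \<alpha>_def power_mult_distrib mult_ac)
  then show ?thesis
    by (simp add: \<beta> abs_le_square_iff[symmetric])
qed simp

lemma bounded_bilinear_cinner: "bounded_bilinear (cinner :: 'a::chilbert_space \<Rightarrow> 'a \<Rightarrow> complex)"
proof
  show "cinner (r *\<^sub>R x) y = r *\<^sub>R cinner x y" for r and x y :: 'a
    by (simp add: scaleR_scaleC cinner_scaleC_left scaleR_conv_of_real)
  show "cinner x (r *\<^sub>R y) = r *\<^sub>R cinner x y" for r and x y :: 'a
    by (simp add: scaleR_scaleC cinner_scaleC_right scaleR_conv_of_real)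
  show "\<exists>K. \<forall>x y. norm (cinner x (y::'a)) \<le> norm x * norm y * K"
    by (rule exI[of _ 1]) (simp add: cinner_cauchy_schwarz)
qed (simp_all add: cinner_add_left cinner_add_right)

lemma cinner_ext:
  fixes x y :: "'a::chilbert_space"
  assumes "\<And>v. cinner x v = cinner y v"
  shows "x = y"
proof -
  have "cinner (x - y) (x - y) = 0"
    using assms by (simp add: cinner_diff_left)
  then show ?thesis by (simp add: cinner_self)
qed

section \<open>Bounded operators, their adjoints and their inverses\<close>

lemma bounded_clinearI:
  assumes "\<And>x y. T (x + y) = T x + T y" "\<And>c x. T (c *\<^sub>C x) = c *\<^sub>C T x"
    and "\<And>x. norm (T x) \<le> K * norm x"
  shows "bounded_clinear T"
  using assms unfolding bounded_clinear_on_def by auto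

context
  fixes T :: "'a::chilbert_space \<Rightarrow> 'a"
  assumes T: "bounded_clinear T"
begin

lemma bounded_clinear_add: "T (x + y) = T x + T y"
  using T unfolding bounded_clinear_on_def by auto

lemma bounded_clinear_scaleC: "T (c *\<^sub>C x) = c *\<^sub>C T x"
  using T unfolding bounded_clinear_on_def by auto

lemma bounded_clinear_minus: "T (- x) = - T x"
  using bounded_clinear_scaleC[of "-1" x] by (simp add: scaleC_one)

lemma bounded_clinear_diff: "T (x - y) = T x - T y"
  by (metis bounded_clinear_add bounded_clinear_minus diff_conv_add_uminus)

lemma bounded_clinear_bound:
  obtains K where "K > 0" "\<And>x. norm (T x) \<le> K * norm x"
proof -
  obtain K where K: "\<And>x. norm (T x) \<le> K * norm x"
    using T unfolding bounded_clinear_on_def by auto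
  have "norm (T x) \<le> max K 1 * norm x" for x
    using K[of x] mult_right_mono[of K "max K 1" "norm x"] by simp
  then show thesis using that[of "max K 1"] by simp
qed

lemma bounded_clinear_bounded_linear: "bounded_linear T"
proof -
  obtain K where "K > 0" "\<And>x. norm (T x) \<le> K * norm x" by (rule bounded_clinear_bound) blast
  then show ?thesis
    by (intro bounded_linear_intro[where K = K])
      (auto simp: bounded_clinear_add scaleR_scaleC bounded_clinear_scaleC mult_ac)
qed

lemma bounded_clinear_tendsto: "(f \<longlongrightarrow> l) F \<Longrightarrow> ((\<lambda>n. T (f n)) \<longlongrightarrow> T l) F"
  by (rule bounded_linear.tendsto[OF bounded_clinear_bounded_linear])

end

lemma bounded_clinear_id: "bounded_clinear id" "bounded_clinear (\<lambda>x. x)"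
  by (rule bounded_clinearI[where K = 1]; simp)+

lemma bounded_clinear_scale:
  assumes "bounded_clinear T"
  shows "bounded_clinear (\<lambda>x. c *\<^sub>C T x)"
proof -
  obtain K where "K > 0" "\<And>x. norm (T x) \<le> K * norm x"
    using assms by (rule bounded_clinear_bound) blast
  then show ?thesis
    by (intro bounded_clinearI[where K = "cmod c * K"])
      (auto simp: bounded_clinear_add[OF assms] bounded_clinear_scaleC[OF assms] norm_scaleC
        scaleC_add_right scaleC_scaleC mult.assoc mult.commute[of c] intro!: mult_left_mono)
qed

lemma bounded_clinear_plus:
  assumes "bounded_clinear T" "bounded_clinear U"
  shows "bounded_clinear (\<lambda>x. T x + U x)"
proof -
  obtain K L where "\<And>x. norm (T x) \<le> K * norm x" "\<And>x. norm (U x) \<le> L * norm x"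
    using assms bounded_clinear_bound by metis
  then show ?thesis
    by (intro bounded_clinearI[where K = "K + L"])
      (auto simp: distrib_right intro: norm_triangle_mono simp: bounded_clinear_add[OF assms(1)] bounded_clinear_scaleC[OF assms(1)]
        bounded_clinear_add[OF assms(2)] bounded_clinear_scaleC[OF assms(2)]
        scaleC_add_right)
qed

lemma bounded_clinear_minus_op:
  assumes "bounded_clinear T" "bounded_clinear U"
  shows "bounded_clinear (\<lambda>x. T x - U x)"
  using bounded_clinear_plus[OF assms(1) bounded_clinear_scale[OF assms(2), of "-1"]]
  by (simp add: scaleC_one)

lemma bounded_clinear_compose:
  assumes "bounded_clinear T" "bounded_clinear U"
  shows "bounded_clinear (\<lambda>x. T (U x))"
proof -
  obtain K where "K > 0" and K: "\<And>x. norm (T x) \<le> K * norm x"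
    using assms(1) by (rule bounded_clinear_bound) blast
  obtain L where "L > 0" and L: "\<And>x. norm (U x) \<le> L * norm x"
    using assms(2) by (rule bounded_clinear_bound) blast
  have "norm (T (U x)) \<le> (K * L) * norm x" for x
    using order_trans[OF K[of "U x"] mult_left_mono[OF L[of x]]] \<open>K > 0\<close> by (simp add: mult.assoc)
  then show ?thesis
    by (intro bounded_clinearI[where K = "K * L"])
      (auto simp: bounded_clinear_add[OF assms(1)] bounded_clinear_scaleC[OF assms(1)]
        bounded_clinear_add[OF assms(2)] bounded_clinear_scaleC[OF assms(2)])
qed

lemmas bounded_clinear_intros = bounded_clinear_id bounded_clinear_scale bounded_clinear_plus
  bounded_clinear_minus_op

text \<open>The constant is a parameter because perturbations and the passage to the adjoint have to
  keep track of it.\<close>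

definition bounded_below_by :: "real \<Rightarrow> ('a::chilbert_space \<Rightarrow> 'a) \<Rightarrow> bool" where
  "bounded_below_by c T \<longleftrightarrow> c > 0 \<and> (\<forall>x. c * norm x \<le> norm (T x))"

text \<open>A relation instead of a function: existence needs the Riesz theorem, while for sums,
  multiples and compositions an adjoint can be written down directly.\<close>

definition adjoint_pair :: "('a::chilbert_space \<Rightarrow> 'a) \<Rightarrow> ('a \<Rightarrow> 'a) \<Rightarrow> bool" where
  "adjoint_pair T T' \<longleftrightarrow> bounded_clinear T \<and> bounded_clinear T' \<and>
     (\<forall>x y. cinner (T' x) y = cinner x (T y))"

lemma adjoint_pair_sym: "adjoint_pair T T' \<Longrightarrow> adjoint_pair T' T"
  unfolding adjoint_pair_def by (metis cinner_commute)

definition invertible_op :: "('a::chilbert_space \<Rightarrow> 'a) \<Rightarrow> bool" where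
  "invertible_op T \<longleftrightarrow> (\<exists>R. bounded_clinear R \<and> (\<forall>x. R (T x) = x \<and> T (R x) = x))"

lemma spectrum_iff: "z \<in> spectrum T \<longleftrightarrow> \<not> invertible_op (\<lambda>x. T x - z *\<^sub>C x)"
  unfolding spectrum_on_def invertible_op_def by simp

lemma quadratic_nonneg_imp_linear_zero:
  fixes a d :: real
  assumes "a \<ge> 0" "\<And>t. 0 \<le> t\<^sup>2 * a + 2 * t * d"
  shows "d = 0"
proof -
  \<comment> \<open>For \<open>a > 0\<close> the quadratic is minimal at \<open>- d / a\<close>; the
    denominator \<open>a + 1\<close> also covers \<open>a = 0\<close>.\<close>
  define t where "t = - d / (a + 1)"
  have t: "t * (a + 1) = - d" using assms(1) by (simp add: t_def)
  have "0 \<le> (t\<^sup>2 * a + 2 * t * d) * (a + 1)\<^sup>2"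
    using assms(2)[of t] by simp
  also have "\<dots> = (t * (a + 1))\<^sup>2 * a + 2 * (t * (a + 1)) * d * (a + 1)"
    by (simp add: power2_eq_square algebra_simps)
  also have "\<dots> = - (d\<^sup>2 * (a + 2))"
    unfolding t by (simp add: power2_eq_square algebra_simps)
  finally show ?thesis
    using assms(1) by (simp add: mult_le_0_iff)
qed

text \<open>The minimiser of \<open>\<parallel>B u\<parallel>\<^sup>2 - 2 Re (\<phi> u)\<close> is the solution. For \<open>B = id\<close> this is the Riesz
  representation theorem.\<close>

lemma coercive_form_represents:
  fixes B :: "'a::chilbert_space \<Rightarrow> 'a"
  assumes B: "bounded_clinear B" and below: "bounded_below_by c B"
    and add: "\<And>u v. \<phi> (u + v) = \<phi> u + \<phi> v" and scale: "\<And>k u. \<phi> (k *\<^sub>C u) = k * \<phi> u"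
    and bound: "\<And>u. cmod (\<phi> u) \<le> K * norm u"
  shows "\<exists>u. \<forall>v. cinner (B u) (B v) = \<phi> v"
proof -
  define J where "J u = (norm (B u))\<^sup>2 - 2 * Re (\<phi> u)" for u
  have c: "c > 0" "\<And>u. c * norm u \<le> norm (B u)"
    using below by (auto simp: bounded_below_by_def)
  have \<phi>: "bounded_linear \<phi>"
    by (intro bounded_linear_intro[where K = K])
      (use bound in \<open>auto simp: add scale scaleR_scaleC scaleR_conv_of_real mult.commute\<close>)
  have B_half: "B (u + v) = 2 *\<^sub>R B ((1/2) *\<^sub>R (u + v))" for u v
    using bounded_linear.linear[OF bounded_clinear_bounded_linear[OF B]]
    by (simp add: linear_cmul)
  have \<phi>_half: "\<phi> u + \<phi> v = 2 * \<phi> ((1/2) *\<^sub>R (u + v))" for u v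
    by (simp add: scaleR_scaleC scale flip: add)
  have parallelogram: "(norm (B (u - v)))\<^sup>2 = 2 * J u + 2 * J v - 4 * J ((1/2) *\<^sub>R (u + v))" for u v
  proof -
    have "(norm (B (u - v)))\<^sup>2 + (norm (B (u + v)))\<^sup>2 = 2 * (norm (B u))\<^sup>2 + 2 * (norm (B v))\<^sup>2"
      by (simp add: bounded_clinear_diff[OF B] bounded_clinear_add[OF B] power2_norm_add power2_norm_diff)
    moreover have "(norm (B (u + v)))\<^sup>2 = 4 * (norm (B ((1/2) *\<^sub>R (u + v))))\<^sup>2"
      by (subst B_half) (simp add: power_mult_distrib)
    moreover have "Re (\<phi> u) + Re (\<phi> v) = 2 * Re (\<phi> ((1/2) *\<^sub>R (u + v)))"
      using arg_cong[OF \<phi>_half[of u v], of Re] by simp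
    ultimately show ?thesis by (simp add: J_def)
  qed
  \<comment> \<open>Completing the square in \<open>c * norm u\<close> leaves the constant
    \<open>(K/c)\<^sup>2\<close>.\<close>
  have J_lower: "J u \<ge> - (K/c)\<^sup>2" for u
  proof -
    have "Re (\<phi> u) \<le> K * norm u"
      using complex_Re_le_cmod[of "\<phi> u"] bound[of u] by linarith
    moreover have "(c * norm u)\<^sup>2 \<le> (norm (B u))\<^sup>2"
      using c by (intro power_mono) auto
    moreover have "(c * norm u)\<^sup>2 - 2 * (K * norm u) + (K/c)\<^sup>2 = (c * norm u - K/c)\<^sup>2"
      using c by (simp add: power2_eq_square field_simps)
    moreover have "(c * norm u - K/c)\<^sup>2 \<ge> 0" by simp
    ultimately show ?thesis unfolding J_def by linarith
  qed
  define m where "m = (INF u. J u)"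
  have bdd: "bdd_below (range J)"
    using J_lower by (rule bdd_belowI2)
  have m_le: "m \<le> J u" for u
    unfolding m_def by (rule cINF_lower[OF bdd]) simp
  have "\<exists>u. J u < m + inverse (real (Suc n))" for n
  proof (rule ccontr)
    assume "\<nexists>u. J u < m + inverse (real (Suc n))"
    then have "m + inverse (real (Suc n)) \<le> (INF u. J u)"
      by (intro cINF_greatest) (auto simp: not_less)
    then show False
      by (simp add: m_def[symmetric])
  qed
  then obtain u where u: "\<And>n. J (u n) < m + inverse (real (Suc n))" by metis
  \<comment> \<open>The midpoint has value at least \<open>m\<close>, so the parallelogram identity
    forces two almost minimal points together. This makes the minimising sequence Cauchy.\<close>
  have close: "(c * norm (u i - u j))\<^sup>2 \<le> 2 * inverse (real (Suc i)) + 2 * inverse (real (Suc j))" for i j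
  proof -
    have "(c * norm (u i - u j))\<^sup>2 \<le> (norm (B (u i - u j)))\<^sup>2"
      using c by (intro power_mono) auto
    also have "\<dots> \<le> 2 * inverse (real (Suc i)) + 2 * inverse (real (Suc j))"
      unfolding parallelogram using u[of i] u[of j] m_le[of "(1/2) *\<^sub>R (u i + u j)"]
      by linarith
    finally show ?thesis .
  qed
  have "Cauchy u"
  proof (rule metric_CauchyI)
    fix e :: real assume "e > 0"
    then have ce: "(c * e)\<^sup>2 / 4 > 0" using c by simp
    then obtain M where M: "inverse (real (Suc M)) < (c * e)\<^sup>2 / 4"
      using reals_Archimedean by blast
    have "dist (u i) (u j) < e" if "i \<ge> M" "j \<ge> M" for i j
    proof -
      have "inverse (real (Suc i)) \<le> inverse (real (Suc M))" "inverse (real (Suc j)) \<le> inverse (real (Suc M))"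
        using that by auto
      then have "(c * norm (u i - u j))\<^sup>2 < (c * e)\<^sup>2"
        using close[of i j] M by linarith
      then have "c * norm (u i - u j) < c * e"
        by (rule power2_less_imp_less) (use c \<open>e > 0\<close> in simp)
      then show ?thesis using c by (simp add: dist_norm)
    qed
    then show "\<exists>M. \<forall>i\<ge>M. \<forall>j\<ge>M. dist (u i) (u j) < e" by blast
  qed
  then obtain w where w: "u \<longlonglongrightarrow> w"
    by (auto simp: Cauchy_convergent_iff convergent_def)
  have "(\<lambda>n. J (u n)) \<longlonglongrightarrow> J w"
    unfolding J_def
    by (intro tendsto_intros bounded_clinear_tendsto[OF B] w bounded_linear.tendsto[OF \<phi>])
  moreover have "(\<lambda>n. m + inverse (real (Suc n))) \<longlonglongrightarrow> m + 0"
    by (intro tendsto_intros LIMSEQ_inverse_real_of_nat)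
  ultimately have "J w \<le> m"
    using LIMSEQ_le[of "\<lambda>n. J (u n)" "J w" "\<lambda>n. m + inverse (real (Suc n))" "m + 0"] less_imp_le[OF u]
    by auto
  then have min: "J w \<le> J v" for v using m_le[of v] by linarith
  have Re_eq: "Re (cinner (B w) (B v)) = Re (\<phi> v)" for v
  proof -
    \<comment> \<open>Half the derivative of \<open>J\<close> at the minimiser \<open>w\<close> in
      the direction \<open>v\<close>. It controls real parts only; the imaginary part comes
      afterwards from the direction \<open>\<i> *\<^sub>C v\<close>.\<close>
    define \<delta> where "\<delta> = Re (cinner (B w) (B v)) - Re (\<phi> v)"
    have "0 \<le> t\<^sup>2 * (norm (B v))\<^sup>2 + 2 * t * \<delta>" for t :: real
    proof -
      have "J (w + complex_of_real t *\<^sub>C v) = J w + t\<^sup>2 * (norm (B v))\<^sup>2 + 2 * t * \<delta>"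
        by (simp add: J_def \<delta>_def bounded_clinear_add[OF B] bounded_clinear_scaleC[OF B] add scale
            power2_norm_add norm_scaleC cinner_scaleC_right power_mult_distrib algebra_simps)
      then show ?thesis using min[of "w + complex_of_real t *\<^sub>C v"] by linarith
    qed
    then have "\<delta> = 0"
      by (rule quadratic_nonneg_imp_linear_zero[rotated]) simp
    then show ?thesis by (simp add: \<delta>_def)
  qed
  have "cinner (B w) (B v) = \<phi> v" for v
  proof (rule complex_eqI[OF Re_eq])
    show "Im (cinner (B w) (B v)) = Im (\<phi> v)"
      using Re_eq[of "\<i> *\<^sub>C v"]
      by (simp add: scale bounded_clinear_scaleC[OF B] cinner_scaleC_right)
  qed
  then show ?thesis by blast
qed

text \<open>The vector \<open>T' x\<close> represents the bounded functional that sends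
  \<open>y\<close> to \<open>cinner x (T y)\<close>. Pairing \<open>T' x\<close> with itself and
  cancelling one factor \<open>norm (T' x)\<close> gives the norm bound.\<close>

lemma adjoint_exists:
  fixes T :: "'a::chilbert_space \<Rightarrow> 'a"
  assumes T: "bounded_clinear T"
  obtains T' where "adjoint_pair T T'"
proof -
  obtain K where K: "K > 0" "\<And>x. norm (T x) \<le> K * norm x"
    using T by (rule bounded_clinear_bound) blast
  have below: "bounded_below_by 1 (\<lambda>x::'a. x)" by (simp add: bounded_below_by_def)
  have "\<exists>u. \<forall>y. cinner u y = cinner x (T y)" for x
  proof (rule coercive_form_represents[OF bounded_clinear_id(2) below])
    show "cmod (cinner x (T u)) \<le> (norm x * K) * norm u" for u
      using cinner_cauchy_schwarz[of x "T u"] mult_left_mono[OF K(2)[of u], of "norm x"]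
      by (simp add: mult.assoc)
  qed (simp_all add: bounded_clinear_add[OF T] bounded_clinear_scaleC[OF T]
      cinner_add_right cinner_scaleC_right)
  then obtain T' where T': "\<And>x y. cinner (T' x) y = cinner x (T y)" by metis
  have "bounded_clinear T'"
  proof (rule bounded_clinearI)
    show "T' (x + y) = T' x + T' y" for x y
      by (rule cinner_ext) (simp add: T' cinner_add_left)
    show "T' (c *\<^sub>C x) = c *\<^sub>C T' x" for c x
      by (rule cinner_ext) (simp add: T' cinner_scaleC_left)
    show "norm (T' x) \<le> K * norm x" for x
    proof -
      have "(norm (T' x))\<^sup>2 = Re (cinner x (T (T' x)))"
        by (simp add: Re_cinner_self[symmetric] T')
      also have "\<dots> \<le> norm x * norm (T (T' x))"
        using complex_Re_le_cmod cinner_cauchy_schwarz order_trans by blast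
      also have "\<dots> \<le> norm x * (K * norm (T' x))"
        by (rule mult_left_mono[OF K(2)]) simp
      finally have "norm (T' x) * norm (T' x) \<le> K * norm x * norm (T' x)"
        by (simp add: power2_eq_square mult_ac)
      then show ?thesis using K(1) by (cases "norm (T' x) = 0") auto
    qed
  qed
  then show thesis using that T T' by (auto simp: adjoint_pair_def)
qed

text \<open>Surjectivity comes from the lower bound of the adjoint: a vector \<open>u\<close> with
  \<open><T' u, T' v> = <x, v>\<close> for all \<open>v\<close> satisfies
  \<open>T (T' u) = x\<close>. The lower bound of \<open>T\<close> gives injectivity and the bound
  \<open>1/c\<close> for the inverse.\<close>

lemma invertible_opI:
  assumes adj: "adjoint_pair T T'" and below: "bounded_below_by c T" "bounded_below_by d T'"
  shows "invertible_op T"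
proof -
  have T: "bounded_clinear T" "bounded_clinear T'"
    using adj by (auto simp: adjoint_pair_def)
  have c: "c > 0" "\<And>x. c * norm x \<le> norm (T x)" using below by (auto simp: bounded_below_by_def)
  have inj: "x = y" if "T x = T y" for x y
  proof -
    have "c * norm (x - y) \<le> 0"
      using c(2)[of "x - y"] that by (simp add: bounded_clinear_diff[OF T(1)])
    then show ?thesis using c(1) by (simp add: mult_le_0_iff)
  qed
  have "\<exists>y. T y = x" for x
  proof -
    obtain u where u: "\<And>v. cinner (T' u) (T' v) = cinner x v"
      using coercive_form_represents[OF T(2) below(2), of "cinner x" "norm x"]
      by (auto simp: cinner_add_right cinner_scaleC_right cinner_cauchy_schwarz)
    have "T (T' u) = x"
      using adjoint_pair_sym[OF adj] u by (intro cinner_ext) (simp add: adjoint_pair_def)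
    then show ?thesis ..
  qed
  then obtain R where R: "\<And>x. T (R x) = x" by metis
  have R': "R (T x) = x" for x by (rule inj) (rule R)
  have "bounded_clinear R"
  proof (rule bounded_clinearI)
    show "R (x + y) = R x + R y" for x y
      by (rule inj) (simp add: R bounded_clinear_add[OF T(1)])
    show "R (k *\<^sub>C x) = k *\<^sub>C R x" for k x
      by (rule inj) (simp add: R bounded_clinear_scaleC[OF T(1)])
    show "norm (R x) \<le> (1/c) * norm x" for x
      using c(2)[of "R x"] c(1) by (simp add: R field_simps)
  qed
  then show ?thesis using R R' unfolding invertible_op_def by blast
qed

text \<open>With \<open>R\<close> the inverse, \<open><x, x> = <x, T (R x)> = <T' x, R x>\<close>,
  so a bound \<open>K\<close> of \<open>R\<close> yields the lower bound \<open>1/K\<close> for the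
  adjoint as well as for \<open>T\<close>.\<close>

lemma invertible_opE:
  assumes inv: "invertible_op T" and adj: "adjoint_pair T T'"
  obtains c where "bounded_below_by c T" "bounded_below_by c T'"
proof -
  obtain R where R: "bounded_clinear R" "\<And>x. R (T x) = x" "\<And>x. T (R x) = x"
    using inv unfolding invertible_op_def by blast
  obtain K where K: "K > 0" "\<And>x. norm (R x) \<le> K * norm x"
    using R(1) by (rule bounded_clinear_bound) blast
  have "norm x \<le> K * norm (T x)" for x
    using K(2)[of "T x"] by (simp add: R)
  moreover have "norm x \<le> K * norm (T' x)" for x
  proof -
    have "(norm x)\<^sup>2 = Re (cinner (T' x) (R x))"
      using adj by (simp add: Re_cinner_self[symmetric] adjoint_pair_def R)
    also have "\<dots> \<le> norm (T' x) * norm (R x)"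
      using complex_Re_le_cmod cinner_cauchy_schwarz order_trans by blast
    also have "\<dots> \<le> norm (T' x) * (K * norm x)"
      by (rule mult_left_mono[OF K(2)]) simp
    finally have "norm x * norm x \<le> K * norm (T' x) * norm x"
      by (simp add: power2_eq_square mult_ac)
    then show ?thesis using K(1) by (cases "norm x = 0") auto
  qed
  ultimately have "bounded_below_by (1/K) T" "bounded_below_by (1/K) T'"
    using K(1) by (auto simp: bounded_below_by_def field_simps)
  then show thesis by (rule that)
qed

lemma invertible_op_adjoint: "adjoint_pair T T' \<Longrightarrow> invertible_op T \<Longrightarrow> invertible_op T'"
  by (metis invertible_opI invertible_opE adjoint_pair_sym)


lemma invertible_op_inv:
  assumes "invertible_op T"
  shows "bounded_clinear (inv T)" "inv T (T x) = x" "T (inv T x) = x"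
proof -
  obtain R where R: "bounded_clinear R" "\<And>x. R (T x) = x" "\<And>x. T (R x) = x"
    using assms unfolding invertible_op_def by blast
  have "inv T = R" by (rule inv_equality) (fact R)+
  with R show "bounded_clinear (inv T)" "inv T (T x) = x" "T (inv T x) = x" by auto
qed

section \<open>Linear pencils\<close>

lemma bounded_below_by_perturb:
  assumes "bounded_below_by c T" "\<And>x. norm (T x - U x) \<le> d * norm x" "d < c"
  shows "bounded_below_by (c - d) U"
  unfolding bounded_below_by_def
proof (intro conjI allI)
  fix x
  have "norm (T x) - norm (T x - U x) \<le> norm (U x)"
    by (metis norm_triangle_ineq2 diff_diff_eq2 add_diff_cancel_left')
  moreover have "c * norm x \<le> norm (T x)"
    using assms(1) by (simp add: bounded_below_by_def)
  ultimately show "(c - d) * norm x \<le> norm (U x)"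
    using assms(2)[of x] unfolding left_diff_distrib by linarith
qed (use assms(3) in simp)

lemma adjoint_pair_id: "adjoint_pair (\<lambda>x. x) (\<lambda>x. x)"
  by (simp add: adjoint_pair_def bounded_clinear_intros)

lemma adjoint_pair_scale: "adjoint_pair T T' \<Longrightarrow> adjoint_pair (\<lambda>x. c *\<^sub>C T x) (\<lambda>x. cnj c *\<^sub>C T' x)"
  by (simp add: adjoint_pair_def bounded_clinear_intros cinner_scaleC_left cinner_scaleC_right)

lemma adjoint_pair_plus:
  "adjoint_pair T T' \<Longrightarrow> adjoint_pair U U' \<Longrightarrow> adjoint_pair (\<lambda>x. T x + U x) (\<lambda>x. T' x + U' x)"
  by (simp add: adjoint_pair_def bounded_clinear_intros cinner_add_left cinner_add_right)

lemma adjoint_pair_minus: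
  "adjoint_pair T T' \<Longrightarrow> adjoint_pair U U' \<Longrightarrow> adjoint_pair (\<lambda>x. T x - U x) (\<lambda>x. T' x - U' x)"
  by (simp add: adjoint_pair_def bounded_clinear_intros cinner_diff_left cinner_diff_right)

lemma adjoint_pair_compose:
  "adjoint_pair T T' \<Longrightarrow> adjoint_pair U U' \<Longrightarrow> adjoint_pair (\<lambda>x. T (U x)) (\<lambda>x. U' (T' x))"
  by (simp add: adjoint_pair_def bounded_clinear_compose)

lemmas adjoint_pair_intros = adjoint_pair_id adjoint_pair_scale adjoint_pair_plus
  adjoint_pair_minus

text \<open>A general \<open>q\<close> in place of the identity lets the resolvent of
  \<open>a\<close> and the inverses of \<open>c - l d\<close> share one theory.\<close>

definition pencil :: "('a::chilbert_space \<Rightarrow> 'a) \<Rightarrow> ('a \<Rightarrow> 'a) \<Rightarrow> complex \<Rightarrow> 'a \<Rightarrow> 'a" where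
  "pencil p q l x = p x - l *\<^sub>C q x"

lemma adjoint_pair_pencil:
  "adjoint_pair p p' \<Longrightarrow> adjoint_pair q q' \<Longrightarrow> adjoint_pair (pencil p q l) (pencil p' q' (cnj l))"
  unfolding pencil_def[abs_def] by (intro adjoint_pair_intros; assumption)

lemma bounded_clinear_pencil:
  "bounded_clinear p \<Longrightarrow> bounded_clinear q \<Longrightarrow> bounded_clinear (pencil p q l)"
  unfolding pencil_def[abs_def] by (intro bounded_clinear_intros; assumption)

lemma bounded_below_by_pencil_near:
  assumes "bounded_below_by c (pencil p q l)" and K: "\<And>x. norm (q x) \<le> K * norm x"
    and near: "cmod (m - l) * K \<le> c / 2"
  shows "bounded_below_by (c / 2) (pencil p q m)"
proof -
  have c: "c > 0" using assms(1) by (simp add: bounded_below_by_def)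
  have "norm (pencil p q l x - pencil p q m x) \<le> (c/2) * norm x" for x
  proof -
    have "norm (pencil p q l x - pencil p q m x) = cmod (m - l) * norm (q x)"
      by (simp add: pencil_def norm_scaleC flip: complex_vector.scale_left_diff_distrib)
    also have "\<dots> \<le> cmod (m - l) * (K * norm x)"
      by (intro mult_left_mono K) simp
    also have "\<dots> \<le> (c/2) * norm x"
      using mult_right_mono[OF near norm_ge_zero[of x]] by (simp add: mult.assoc)
    finally show ?thesis .
  qed
  from bounded_below_by_perturb[OF assms(1) this] c show ?thesis by simp
qed

context
  fixes p q :: "'a::chilbert_space \<Rightarrow> 'a"
  assumes p: "bounded_clinear p" and q: "bounded_clinear q"
begin

lemma pencil_invertible_near:
  assumes "invertible_op (pencil p q l)"
  obtains r M where "r > 0" "M > 0"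
    "\<And>m. cmod (m - l) < r \<Longrightarrow> invertible_op (pencil p q m)"
    "\<And>m x. cmod (m - l) < r \<Longrightarrow> norm (inv (pencil p q m) x) \<le> M * norm x"
proof -
  obtain p' where p': "adjoint_pair p p'" using p by (rule adjoint_exists)
  obtain q' where q': "adjoint_pair q q'" using q by (rule adjoint_exists)
  obtain K where K: "K > 0" "\<And>x. norm (q x) \<le> K * norm x"
    using q by (rule bounded_clinear_bound) blast
  obtain L where L: "L > 0" "\<And>x. norm (q' x) \<le> L * norm x"
    using q' by (auto simp: adjoint_pair_def elim: bounded_clinear_bound)
  obtain c where c: "bounded_below_by c (pencil p q l)" "bounded_below_by c (pencil p' q' (cnj l))"
    using invertible_opE[OF assms adjoint_pair_pencil[OF p' q']] .
  have c0: "c > 0" using c by (simp add: bounded_below_by_def)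
  \<comment> \<open>The number \<open>K + L\<close> dominates the bounds of \<open>q\<close> and
    \<open>q'\<close>, so one radius costs at most half of \<open>c\<close> for the pencil and for
    its adjoint. The lower bound \<open>c / 2\<close> that remains is uniform in
    \<open>m\<close>.\<close>
  define r where "r = c / (2 * (K + L))"
  have r: "r > 0" using c0 K L by (simp add: r_def)
  have near: "cmod (m - l) * K \<le> c / 2" "cmod (cnj m - cnj l) * L \<le> c / 2" if "cmod (m - l) < r" for m
  proof -
    have "cmod (m - l) * (K + L) \<le> c / 2"
      using that K L by (simp add: r_def field_simps)
    moreover have "cmod (m - l) * (K + L) = cmod (m - l) * K + cmod (m - l) * L"
      by (simp add: distrib_left)
    moreover have "cmod (m - l) * K \<ge> 0" "cmod (m - l) * L \<ge> 0" using K L by auto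
    ultimately show "cmod (m - l) * K \<le> c / 2" "cmod (cnj m - cnj l) * L \<le> c / 2"
      by (auto simp flip: complex_cnj_diff)
  qed
  have inv: "invertible_op (pencil p q m)" and below: "bounded_below_by (c/2) (pencil p q m)"
    if "cmod (m - l) < r" for m
  proof -
    show below: "bounded_below_by (c/2) (pencil p q m)"
      by (rule bounded_below_by_pencil_near[OF c(1) K(2) near(1)[OF that]])
    show "invertible_op (pencil p q m)"
      by (rule invertible_opI[OF adjoint_pair_pencil[OF p' q'] below
          bounded_below_by_pencil_near[OF c(2) L(2) near(2)[OF that]]])
  qed
  have "norm (inv (pencil p q m) x) \<le> (2/c) * norm x" if "cmod (m - l) < r" for m x
  proof -
    have "(c/2) * norm (inv (pencil p q m) x) \<le> norm x"
      using below[OF that] invertible_op_inv(3)[OF inv[OF that], of x]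
      by (metis bounded_below_by_def)
    then show ?thesis using c0 by (simp add: field_simps)
  qed
  note bound = this
  have "2 / c > 0" using c0 by simp
  with r show thesis by (rule that[OF _ _ inv bound])
qed

lemma open_pencil_invertible: "open {l. invertible_op (pencil p q l)}"
proof (rule openI)
  fix l assume "l \<in> {l. invertible_op (pencil p q l)}"
  then have "invertible_op (pencil p q l)" by simp
  then obtain r where "r > 0" "\<And>m. cmod (m - l) < r \<Longrightarrow> invertible_op (pencil p q m)"
    by (rule pencil_invertible_near) (rule that)
  then show "\<exists>r>0. ball l r \<subseteq> {l. invertible_op (pencil p q l)}"
    by (intro exI[of _ r]) (auto simp: dist_norm norm_minus_commute)
qed

text \<open>Supplies the boundedness on compact sets that Montel's theorem asks for; the locally
  uniform bounds combine over a finite subcover.\<close>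

lemma pencil_inv_bounded_on_compact:
  assumes "compact C" "C \<subseteq> {l. invertible_op (pencil p q l)}"
  shows "\<exists>M>0. \<forall>l\<in>C. \<forall>x. norm (inv (pencil p q l) x) \<le> M * norm x"
proof -
  have "\<exists>r M. r > 0 \<and> (\<forall>m x. cmod (m - l) < r \<longrightarrow> norm (inv (pencil p q m) x) \<le> M * norm x)"
    if "l \<in> C" for l
  proof -
    have "invertible_op (pencil p q l)" using assms(2) that by auto
    then show ?thesis by (rule pencil_invertible_near) blast
  qed
  then have "\<exists>r M. \<forall>l\<in>C. r l > 0 \<and>
      (\<forall>m x. cmod (m - l) < r l \<longrightarrow> norm (inv (pencil p q m) x) \<le> M l * norm x)"
    by metis
  then obtain r M where r: "\<And>l. l \<in> C \<Longrightarrow> r l > 0"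
    and M: "\<And>l m x. l \<in> C \<Longrightarrow> cmod (m - l) < r l \<Longrightarrow> norm (inv (pencil p q m) x) \<le> M l * norm x"
    by blast
  have "C \<subseteq> (\<Union>l\<in>C. ball l (r l))" using r by force
  with assms(1) obtain D where D: "D \<subseteq> C" "finite D" "C \<subseteq> (\<Union>l\<in>D. ball l (r l))"
    using compactE_image[of C C "\<lambda>l. ball l (r l)"] open_ball by blast
  \<comment> \<open>A sum of absolute values serves as a common upper bound; the summand 1 keeps it
    positive even for an empty subcover.\<close>
  define N where "N = 1 + (\<Sum>l\<in>D. \<bar>M l\<bar>)"
  have "norm (inv (pencil p q m) x) \<le> N * norm x" if m: "m \<in> C" for m x
  proof -
    obtain l where l: "l \<in> D" "cmod (m - l) < r l"
      using D(3) m by (auto simp: dist_norm norm_minus_commute)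
    have "\<bar>M l\<bar> \<le> (\<Sum>l\<in>D. \<bar>M l\<bar>)"
      using D(2) l(1) by (intro member_le_sum) auto
    then have "M l \<le> N" unfolding N_def by linarith
    then show ?thesis
      using M[OF _ l(2), of x] D(1) l(1) mult_right_mono[of "M l" N "norm x"] by force
  qed
  moreover have "N > 0" unfolding N_def by (simp add: add_pos_nonneg sum_nonneg)
  ultimately show ?thesis by blast
qed

text \<open>The pencil at \<open>m\<close> maps the resolvent vector at \<open>l\<close> to
  \<open>x\<close> minus \<open>m - l\<close> times the image of that vector under \<open>q\<close>.
  Inverting the pencil at \<open>m\<close> gives the difference, and thereby explicit difference
  quotients.\<close>

lemma pencil_resolvent_identity:
  assumes "invertible_op (pencil p q l)" "invertible_op (pencil p q m)"
  shows "inv (pencil p q m) x - inv (pencil p q l) x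
    = (m - l) *\<^sub>C inv (pencil p q m) (q (inv (pencil p q l) x))"
proof -
  let ?y = "inv (pencil p q l) x"
  note R = invertible_op_inv[OF assms(2)]
  have "pencil p q m ?y = x - (m - l) *\<^sub>C q ?y"
    using invertible_op_inv(3)[OF assms(1), of x]
    by (simp add: pencil_def complex_vector.scale_left_diff_distrib algebra_simps)
  then have "?y = inv (pencil p q m) x - (m - l) *\<^sub>C inv (pencil p q m) (q ?y)"
    using R(2)[of ?y] by (simp add: bounded_clinear_diff[OF R(1)] bounded_clinear_scaleC[OF R(1)])
  then show ?thesis by (simp add: algebra_simps)
qed

text \<open>By the resolvent identity, the difference quotient at \<open>l\<close> is a function of
  the same kind with \<open>x\<close> replaced by \<open>q (inv (pencil p q l) x)\<close>.
  Continuity of all these scalar functions therefore yields differentiability.\<close>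

lemma holomorphic_pencil_inv:
  "(\<lambda>l. cinner y (q (inv (pencil p q l) x))) holomorphic_on {l. invertible_op (pencil p q l)}"
    (is "?g holomorphic_on ?S")
proof -
  let ?R = "\<lambda>l. inv (pencil p q l)"
  obtain K where K: "K > 0" "\<And>x. norm (q x) \<le> K * norm x"
    using q by (rule bounded_clinear_bound) blast
  have cont: "isCont (\<lambda>l. cinner y (q (?R l w))) l" if l: "l \<in> ?S" for l w
  proof -
    have "invertible_op (pencil p q l)" using l by simp
    then obtain r M where r: "r > 0" "M > 0"
      "\<And>m. cmod (m - l) < r \<Longrightarrow> invertible_op (pencil p q m)"
      "\<And>m x. cmod (m - l) < r \<Longrightarrow> norm (?R m x) \<le> M * norm x"
      by (rule pencil_invertible_near) blast
    let ?B = "norm y * (K * (M * (K * norm (?R l w))))"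
    have "cmod (cinner y (q (?R m w)) - cinner y (q (?R l w))) \<le> cmod (m - l) * ?B"
      if m: "cmod (m - l) < r" for m
    proof -
      have "cinner y (q (?R m w)) - cinner y (q (?R l w)) = (m - l) * cinner y (q (?R m (q (?R l w))))"
        using pencil_resolvent_identity[of l m w] l r(3)[OF m]
        by (simp flip: cinner_diff_right bounded_clinear_diff[OF q])
          (simp add: bounded_clinear_scaleC[OF q] cinner_scaleC_right)
      moreover have "cmod (cinner y (q (?R m (q (?R l w))))) \<le> ?B"
      proof -
        have "norm (q (?R m (q (?R l w)))) \<le> K * norm (?R m (q (?R l w)))" by (rule K)
        also have "\<dots> \<le> K * (M * norm (q (?R l w)))"
          using K(1) by (intro mult_left_mono r(4)[OF m]) auto
        also have "\<dots> \<le> K * (M * (K * norm (?R l w)))"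
          using K r(2) by (intro mult_left_mono K(2)) auto
        finally show ?thesis
          by (intro order_trans[OF cinner_cauchy_schwarz] mult_left_mono) auto
      qed
      ultimately show ?thesis
        by (simp add: norm_mult mult_left_mono)
    qed
    then have "\<forall>\<^sub>F m in at l. cmod (cinner y (q (?R m w)) - cinner y (q (?R l w))) \<le> cmod (m - l) * ?B"
      using r(1) unfolding eventually_at by (auto simp: dist_norm)
    moreover have "((\<lambda>m. cmod (m - l) * ?B) \<longlongrightarrow> 0) (at l)"
      by (rule tendsto_mult_left_zero) (simp add: LIM_zero tendsto_norm_zero)
    ultimately have "((\<lambda>m. cinner y (q (?R m w)) - cinner y (q (?R l w))) \<longlongrightarrow> 0) (at l)"
      by (rule Lim_null_comparison)
    then show ?thesis unfolding isCont_def by (rule LIM_zero_cancel)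
  qed
  show ?thesis
  proof (subst holomorphic_on_open[OF open_pencil_invertible], intro ballI)
    fix l assume l: "l \<in> ?S"
    let ?w = "q (?R l x)"
    have lim: "((\<lambda>m. cinner y (q (?R m ?w))) \<longlongrightarrow> cinner y (q (?R l ?w))) (at l)"
      using cont[OF l] by (simp add: isCont_def)
    have ratio: "(?g m - ?g l) / (m - l) = cinner y (q (?R m ?w))" if "m \<in> ?S" "m \<noteq> l" for m
      using pencil_resolvent_identity[of l m x] l that
      by (simp flip: cinner_diff_right bounded_clinear_diff[OF q])
        (simp add: bounded_clinear_scaleC[OF q] cinner_scaleC_right)
    have "((\<lambda>m. (?g m - ?g l) / (m - l)) \<longlongrightarrow> cinner y (q (?R l ?w))) (at l)"
      by (rule Lim_transform_within_open[OF lim open_pencil_invertible l]) (rule ratio[symmetric])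
    then show "\<exists>f'. (?g has_field_derivative f') (at l)"
      unfolding has_field_derivative_iff by blast
  qed
qed

end

text \<open>For an invertible operator the lower bound passes to the adjoint with the same constant,
  however large the a priori norm of the inverse. The exact constant matters when the operator
  varies, as in \<open>invertible_limit_bounded_below\<close>.\<close>

lemma adjoint_bounded_below:
  assumes inv: "invertible_op T" and adj: "adjoint_pair T T'" and below: "bounded_below_by c T"
  shows "bounded_below_by c T'"
proof -
  obtain R where R: "\<And>x. T (R x) = x"
    using inv unfolding invertible_op_def by blast
  have c: "c > 0" "\<And>x. c * norm (R x) \<le> norm x"
    using below R unfolding bounded_below_by_def by metis+
  have "c * norm x \<le> norm (T' x)" for x
  proof -
    have "(norm x)\<^sup>2 = Re (cinner (T' x) (R x))"
      using adj by (simp add: Re_cinner_self[symmetric] adjoint_pair_def R)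
    also have "\<dots> \<le> norm (T' x) * norm (R x)"
      using complex_Re_le_cmod cinner_cauchy_schwarz order_trans by blast
    finally have "c * (norm x)\<^sup>2 \<le> norm (T' x) * (c * norm (R x))"
      using c(1) by (simp add: mult.left_commute)
    also have "\<dots> \<le> norm (T' x) * norm x"
      by (rule mult_left_mono[OF c(2)]) simp
    finally have "(c * norm x) * norm x \<le> norm (T' x) * norm x"
      by (simp add: power2_eq_square mult_ac)
    then show ?thesis by (cases "norm x = 0") auto
  qed
  with c(1) show ?thesis by (simp add: bounded_below_by_def)
qed

lemma invertible_op_iff:
  assumes adj: "adjoint_pair T T'"
  shows "invertible_op T \<longleftrightarrow> (\<exists>c. bounded_below_by c T) \<and> (\<exists>c. bounded_below_by c T')"
  using invertible_opI[OF adj] invertible_opE[OF _ adj] by metis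

lemma bounded_below_by_pencil_far:
  fixes T :: "'a::chilbert_space \<Rightarrow> 'a"
  assumes K: "\<And>x. norm (T x) \<le> K * norm x" and "K < cmod l"
  shows "bounded_below_by (cmod l - K) (pencil T (\<lambda>x. x) l)"
  unfolding bounded_below_by_def
proof (intro conjI allI)
  fix x
  have "norm (l *\<^sub>C x) - norm (T x) \<le> norm (pencil T (\<lambda>x. x) l x)"
    unfolding pencil_def by (metis norm_minus_commute norm_triangle_ineq2)
  then show "(cmod l - K) * norm x \<le> norm (pencil T (\<lambda>x. x) l x)"
    using K[of x] unfolding norm_scaleC left_diff_distrib by linarith
qed (use assms(2) in simp)

lemma pencil_invertible_far:
  fixes T :: "'a::chilbert_space \<Rightarrow> 'a"
  assumes "bounded_clinear T"
  obtains L where "L > 0" "\<And>l. L \<le> cmod l \<Longrightarrow> invertible_op (pencil T (\<lambda>x. x) l)"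
proof -
  obtain T' where T': "adjoint_pair T T'" using assms by (rule adjoint_exists)
  then have "bounded_clinear T'" by (simp add: adjoint_pair_def)
  then obtain K' where K': "K' > 0" "\<And>x. norm (T' x) \<le> K' * norm x"
    by (rule bounded_clinear_bound) blast
  obtain K where K: "K > 0" "\<And>x. norm (T x) \<le> K * norm x"
    using assms by (rule bounded_clinear_bound) blast
  have "invertible_op (pencil T (\<lambda>x. x) l)" if "K + K' \<le> cmod l" for l
  proof (rule invertible_opI[OF adjoint_pair_pencil[OF T' adjoint_pair_id]])
    show "bounded_below_by (cmod l - K) (pencil T (\<lambda>x. x) l)"
      by (rule bounded_below_by_pencil_far[OF K(2)]) (use that K' in linarith)
    show "bounded_below_by (cmod (cnj l) - K') (pencil T' (\<lambda>x. x) (cnj l))"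
      by (rule bounded_below_by_pencil_far[OF K'(2)]) (use that K in simp)
  qed
  with K K' show thesis by (intro that[of "K + K'"]; simp)
qed

lemma unit_vectors_of_not_bounded_below:
  fixes T :: "'a::chilbert_space \<Rightarrow> 'a"
  assumes T: "bounded_clinear T" and "\<nexists>c. bounded_below_by c T"
  obtains x where "\<And>n. norm (x n) = 1" "\<And>n. norm (T (x n)) < inverse (real (Suc n))"
proof -
  have "\<exists>x. norm x = 1 \<and> norm (T x) < inverse (real (Suc n))" for n
  proof -
    have "\<not> bounded_below_by (inverse (real (Suc n))) T" using assms(2) by blast
    then obtain x where x: "norm (T x) < inverse (real (Suc n)) * norm x"
      by (auto simp: bounded_below_by_def not_le)
    then have "x \<noteq> 0" using bounded_clinear_scaleC[OF T, of 0 x] by auto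
    let ?y = "complex_of_real (inverse (norm x)) *\<^sub>C x"
    have "norm ?y = 1" using \<open>x \<noteq> 0\<close> by (simp add: norm_scaleC norm_inverse)
    moreover have "norm (T ?y) < inverse (real (Suc n))"
    proof -
      have "norm (T ?y) = norm (T x) / norm x"
        by (simp add: bounded_clinear_scaleC[OF T] norm_scaleC norm_inverse divide_inverse)
      also have "\<dots> < inverse (real (Suc n))"
        using x \<open>x \<noteq> 0\<close> by (simp add: pos_divide_less_eq del: of_nat_Suc)
      finally show ?thesis .
    qed
    ultimately show ?thesis by blast
  qed
  then have "\<exists>x. \<forall>n. norm (x n) = 1 \<and> norm (T (x n)) < inverse (real (Suc n))"
    by (intro choice) blast
  then show thesis using that by blast
qed

section \<open>Commuting pencils\<close>

context
  fixes a c d :: "'a::chilbert_space \<Rightarrow> 'a"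
  assumes a: "bounded_clinear a" and c: "bounded_clinear c" and d: "bounded_clinear d"
    and ac: "\<And>x. a (c x) = c (a x)" and ad: "\<And>x. a (d x) = d (a x)" and cd: "\<And>x. c (d x) = d (c x)"
begin

text \<open>Applying \<open>Q P\<close> to the left side gives \<open>Q x - P (d x)\<close>, where
  the two terms with \<open>l\<close> cancel and \<open>c x - a (d x)\<close> remains. Hence the two
  expressions nearly agree on approximate null vectors of \<open>a d - c\<close>.\<close>

lemma commuting_pencils_difference:
  fixes l :: complex
  defines "P \<equiv> pencil a (\<lambda>x. x) l" and "Q \<equiv> pencil c d l"
  assumes P: "invertible_op P" and Q: "invertible_op Q"
  shows "inv P x - d (inv Q x) = - inv P (inv Q (a (d x) - c x))"
proof -
  note lin = bounded_clinear_diff bounded_clinear_scaleC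
  note P' = invertible_op_inv[OF P] and Q' = invertible_op_inv[OF Q]
  have bcl: "bounded_clinear P" "bounded_clinear Q"
    unfolding P_def Q_def by (auto intro: bounded_clinear_pencil a c d bounded_clinear_id)
  have comm: "Q (P y) = P (Q y)" for y
    by (simp add: P_def Q_def pencil_def lin[OF a] lin[OF c] lin[OF d] ac ad
        complex_vector.scale_right_diff_distrib algebra_simps)
  have Pd: "P (d y) = d (P y)" "Q (d y) = d (Q y)" for y
    by (simp_all add: P_def Q_def pencil_def lin[OF d] ad cd)
  have "Q (P (inv P x - d (inv Q x))) = Q x - P (d x)"
    by (simp add: bcl[THEN bounded_clinear_diff] P'(3) comm Pd Q'(3))
  also have "\<dots> = - (a (d x) - c x)"
    by (simp add: P_def Q_def pencil_def)
  finally have "inv P (inv Q (Q (P (inv P x - d (inv Q x))))) = inv P (inv Q (- (a (d x) - c x)))"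
    by simp
  then show ?thesis
    by (simp only: P'(2) Q'(2) bounded_clinear_minus[OF Q'(1)] bounded_clinear_minus[OF P'(1)])
qed

text \<open>Suppose \<open>ad - c\<close> is not bounded below, with approximate null vectors \<open>x\<^sub>n\<close>. Where both exist,
  \<open>\<langle>x\<^sub>n, (a - l)\<^sup>-\<^sup>1 x\<^sub>n\<rangle>\<close> and \<open>\<langle>x\<^sub>n, d (c - l d)\<^sup>-\<^sup>1 x\<^sub>n\<rangle>\<close> differ by a null sequence, so Montel limits of
  the two families glue to an entire function. It vanishes by Liouville, but behaves as \<open>-1/l\<close> at
  infinity.\<close>

lemma commuting_pencils_bounded_below:
  assumes cover: "\<And>l. invertible_op (pencil a (\<lambda>x. x) l) \<or> invertible_op (pencil c d l)"
  shows "\<exists>e. bounded_below_by e (\<lambda>x. a (d x) - c x)"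
proof (rule ccontr)
  let ?T = "\<lambda>x. a (d x) - c x"
  let ?P = "\<lambda>l. pencil a (\<lambda>x. x) l" and ?Q = "\<lambda>l. pencil c d l"
  have T: "bounded_clinear ?T"
    by (rule bounded_clinear_minus_op[OF bounded_clinear_compose[OF a d] c])
  assume "\<nexists>e. bounded_below_by e ?T"
  then obtain x where x: "\<And>n. norm (x n) = 1" and Tx: "\<And>n. norm (?T (x n)) < inverse (real (Suc n))"
    using unit_vectors_of_not_bounded_below[OF T] by blast
  have Tx0: "(\<lambda>n. ?T (x n)) \<longlonglongrightarrow> 0"
    by (rule Lim_null_comparison[OF _ LIMSEQ_inverse_real_of_nat])
      (auto intro: always_eventually less_imp_le[OF Tx] simp del: of_nat_Suc)
  define S1 S2 where "S1 = {l. invertible_op (?P l)}" and "S2 = {l. invertible_op (?Q l)}"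
  have S: "S1 \<union> S2 = UNIV" using cover by (auto simp: S1_def S2_def)
  have op: "open S1" "open S2"
    unfolding S1_def S2_def by (intro open_pencil_invertible a c d bounded_clinear_id)+
  define f1 where "f1 n l = cinner (x n) (inv (?P l) (x n))" for n l
  define f2 where "f2 n l = cinner (x n) (d (inv (?Q l) (x n)))" for n l
  have hol: "f1 n holomorphic_on S1" "f2 n holomorphic_on S2" for n
    using holomorphic_pencil_inv[OF a bounded_clinear_id(2), of "x n" "x n"]
      holomorphic_pencil_inv[OF c d, of "x n" "x n"]
    by (simp_all add: f1_def[abs_def] f2_def[abs_def] S1_def S2_def)
  have cs: "cmod (cinner (x n) y) \<le> norm y" for n y
    using cinner_cauchy_schwarz[of "x n" y] by (simp add: x)
  have bd1: "\<exists>B. \<forall>h\<in>range f1. \<forall>z\<in>C. norm (h z) \<le> B" if C: "compact C" "C \<subseteq> S1" for C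
  proof -
    obtain M where M: "\<And>l y. l \<in> C \<Longrightarrow> norm (inv (?P l) y) \<le> M * norm y"
      using pencil_inv_bounded_on_compact[OF a bounded_clinear_id(2) C(1)] C(2)
      unfolding S1_def by blast
    have "norm (f1 n z) \<le> M" if "z \<in> C" for n z
      using order_trans[OF cs[of n] M[OF that, of "x n"]] by (simp add: f1_def x)
    then show ?thesis by auto
  qed
  have bd2: "\<exists>B. \<forall>h\<in>range f2. \<forall>z\<in>C. norm (h z) \<le> B" if C: "compact C" "C \<subseteq> S2" for C
  proof -
    obtain M where M: "\<And>l y. l \<in> C \<Longrightarrow> norm (inv (?Q l) y) \<le> M * norm y"
      using pencil_inv_bounded_on_compact[OF c d C(1)] C(2) unfolding S2_def by blast
    obtain K where K: "K > 0" "\<And>x. norm (d x) \<le> K * norm x"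
      using d by (rule bounded_clinear_bound) blast
    have "norm (f2 n z) \<le> K * M" if z: "z \<in> C" for n z
    proof -
      have "norm (f2 n z) \<le> K * norm (inv (?Q z) (x n))"
        unfolding f2_def by (rule order_trans[OF cs K(2)])
      also have "\<dots> \<le> K * M"
        using M[OF z, of "x n"] K(1) by (simp add: x)
      finally show ?thesis .
    qed
    then show ?thesis by auto
  qed
  obtain g1 r1 where g1: "g1 holomorphic_on S1" and r1: "strict_mono (r1 :: nat \<Rightarrow> nat)"
    and lim1: "\<And>l. l \<in> S1 \<Longrightarrow> (\<lambda>n. f1 (r1 n) l) \<longlonglongrightarrow> g1 l"
    by (rule Montel[of S1 "range f1" f1]) (use op hol bd1 in auto)
  \<comment> \<open>The second extraction runs along \<open>r1\<close>, so that
    \<open>r1 (r2 n)\<close> serves both families and their limits can be compared.\<close>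
  obtain g2 r2 where g2: "g2 holomorphic_on S2" and r2: "strict_mono (r2 :: nat \<Rightarrow> nat)"
    and lim2: "\<And>l. l \<in> S2 \<Longrightarrow> (\<lambda>n. f2 (r1 (r2 n)) l) \<longlonglongrightarrow> g2 l"
    by (rule Montel[of S2 "range f2" "\<lambda>n. f2 (r1 n)"]) (use op hol bd2 in auto)
  have lim1': "(\<lambda>n. f1 (r1 (r2 n)) l) \<longlonglongrightarrow> g1 l" if "l \<in> S1" for l
    using LIMSEQ_subseq_LIMSEQ[OF lim1[OF that] r2] by (simp add: o_def)
  have agree: "g1 l = g2 l" if l: "l \<in> S1" "l \<in> S2" for l
  proof -
    have inv: "invertible_op (?P l)" "invertible_op (?Q l)" using l by (auto simp: S1_def S2_def)
    have "(\<lambda>n. ?T (x (r1 (r2 n)))) \<longlonglongrightarrow> 0"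
      using LIMSEQ_subseq_LIMSEQ[OF Tx0 strict_mono_o[OF r1 r2]] by (simp add: o_def)
    from bounded_clinear_tendsto[OF invertible_op_inv(1)[OF inv(1)]
        bounded_clinear_tendsto[OF invertible_op_inv(1)[OF inv(2)] this]]
    moreover have "inv (?P l) (inv (?Q l) 0) = 0"
      using bounded_clinear_diff[OF invertible_op_inv(1)[OF inv(1)], of 0 0]
        bounded_clinear_diff[OF invertible_op_inv(1)[OF inv(2)], of 0 0] by simp
    ultimately have "(\<lambda>n. norm (inv (?P l) (inv (?Q l) (?T (x (r1 (r2 n))))))) \<longlonglongrightarrow> 0"
      by (intro tendsto_norm_zero) simp
    then have "(\<lambda>n. f1 (r1 (r2 n)) l - f2 (r1 (r2 n)) l) \<longlonglongrightarrow> 0"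
    proof (rule Lim_null_comparison[rotated], intro always_eventually allI)
      fix n
      have "f1 n l - f2 n l = cinner (x n) (- inv (?P l) (inv (?Q l) (?T (x n))))" for n
        unfolding f1_def f2_def cinner_diff_right[symmetric] commuting_pencils_difference[OF inv] ..
      then show "norm (f1 (r1 (r2 n)) l - f2 (r1 (r2 n)) l)
        \<le> norm (inv (?P l) (inv (?Q l) (?T (x (r1 (r2 n))))))"
        by (metis cs norm_minus_cancel)
    qed
    moreover have "(\<lambda>n. f1 (r1 (r2 n)) l - f2 (r1 (r2 n)) l) \<longlonglongrightarrow> g1 l - g2 l"
      by (intro tendsto_diff lim1' lim2 l)
    ultimately show ?thesis using LIMSEQ_unique by fastforce
  qed
  define g where "g l = (if l \<in> S1 then g1 l else g2 l)" for l
  have "g holomorphic_on S1 \<union> S2"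
  proof (rule holomorphic_on_Un[OF _ _ op])
    show "g holomorphic_on S1" using g1 by (rule holomorphic_transform) (simp add: g_def)
    show "g holomorphic_on S2" using g2 by (rule holomorphic_transform) (use agree in \<open>auto simp: g_def\<close>)
  qed
  then have ent: "g holomorphic_on UNIV" by (simp add: S)
  obtain K where K: "K > 0" "\<And>x. norm (a x) \<le> K * norm x"
    using a by (rule bounded_clinear_bound) blast
  obtain L where L: "L > 0" "\<And>l. L \<le> cmod l \<Longrightarrow> invertible_op (?P l)"
    using a by (rule pencil_invertible_far) blast
  \<comment> \<open>With \<open>y\<close> the resolvent vector of \<open>x n\<close>, the expression
    \<open>l * f1 n l + 1\<close> equals \<open><x n, a y>\<close>. From
    \<open>3 * K \<le> cmod l\<close> follows \<open>2 * K * norm y \<le> 1\<close>, hence the bound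
    \<open>1/2\<close>; any constant below 1 would contradict \<open>g = 0\<close>. The summand
    \<open>L\<close> places \<open>l\<close> in \<open>S1\<close>, where \<open>g\<close> is
    \<open>g1\<close>.\<close>
  have asym: "cmod (l * g l + 1) \<le> 1/2" if "L + 3 * K \<le> cmod l" for l
  proof -
    have lK: "3 * K \<le> cmod l" "K < cmod l" and inv: "invertible_op (?P l)" using that K(1) L by auto
    then have S1: "l \<in> S1" by (simp add: S1_def)
    have "cmod (l * f1 n l + 1) \<le> 1/2" for n
    proof -
      let ?y = "inv (?P l) (x n)"
      have y: "a ?y = x n + l *\<^sub>C ?y"
        using invertible_op_inv(3)[OF inv, of "x n"] by (simp add: pencil_def algebra_simps)
      have "(cmod l - K) * norm ?y \<le> 1"
        using bounded_below_by_pencil_far[OF K(2) lK(2)] invertible_op_inv(3)[OF inv, of "x n"] x[of n]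
        unfolding bounded_below_by_def by metis
      moreover have "(2 * K) * norm ?y \<le> (cmod l - K) * norm ?y"
        using lK by (intro mult_right_mono) auto
      ultimately have "K * norm ?y \<le> 1/2" by simp
      moreover have "l * f1 n l + 1 = cinner (x n) (a ?y)"
        unfolding y by (simp add: f1_def cinner_add_right cinner_scaleC_right cinner_self x)
      ultimately show ?thesis
        using cs[of n "a ?y"] K(2)[of ?y] by simp
    qed
    moreover have "(\<lambda>n. cmod (l * f1 (r1 (r2 n)) l + 1)) \<longlonglongrightarrow> cmod (l * g1 l + 1)"
      by (intro tendsto_intros lim1' S1)
    ultimately have "cmod (l * g1 l + 1) \<le> 1/2"
      by (intro LIMSEQ_le_const2[where a = "1/2"]) auto
    then show ?thesis using S1 by (simp add: g_def)
  qed
  have "(g \<longlongrightarrow> 0) at_infinity"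
  proof (rule Lim_null_comparison)
    show "\<forall>\<^sub>F l in at_infinity. norm (g l) \<le> norm (2 / l)"
      unfolding eventually_at_infinity
    proof (intro exI allI impI)
      fix l assume l: "L + 3 * K \<le> cmod l"
      have "cmod (l * g l) \<le> cmod (l * g l + 1) + cmod 1"
        using norm_triangle_ineq4[of "l * g l + 1" 1] by simp
      then have "cmod l * cmod (g l) \<le> 2" using asym[OF l] by (simp add: norm_mult)
      moreover have "cmod l > 0" using l L(1) K(1) by linarith
      ultimately show "norm (g l) \<le> norm (2 / l)" by (simp add: norm_divide field_simps)
    qed
    show "((\<lambda>l. norm (2 / l :: complex)) \<longlongrightarrow> 0) at_infinity"
      by (intro tendsto_norm_zero tendsto_divide_0[OF tendsto_const] filterlim_ident)
  qed
  then have "g l = 0" for l by (rule Liouville_weak_0[OF ent])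
  moreover have "L + 3 * K \<le> cmod (complex_of_real (L + 3 * K))"
    using L(1) K(1) by (simp only: norm_of_real)
  ultimately show False using asym[of "complex_of_real (L + 3 * K)"] by simp
qed

end

lemma commuting_adjoints:
  assumes "adjoint_pair S S'" "adjoint_pair T T'" "\<And>x. S (T x) = T (S x)"
  shows "S' (T' x) = T' (S' x)"
  using assms by (intro cinner_ext) (simp add: adjoint_pair_def)

text \<open>The covering condition and the commutation relations pass to the adjoints, with
  \<open>l\<close> conjugated, so the lower bound is available for \<open>a d - c\<close> and for
  its adjoint. The adjoint of \<open>a d\<close> is \<open>d' a'\<close>, which commutation turns
  into \<open>a' d'\<close>.\<close>

lemma commuting_pencils_invertible:
  assumes a: "bounded_clinear a" and c: "bounded_clinear c" and d: "bounded_clinear d"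
    and comm: "\<And>x. a (c x) = c (a x)" "\<And>x. a (d x) = d (a x)" "\<And>x. c (d x) = d (c x)"
    and cover: "\<And>l. invertible_op (pencil a (\<lambda>x. x) l) \<or> invertible_op (pencil c d l)"
  shows "invertible_op (\<lambda>x. a (d x) - c x)"
proof -
  obtain a' where a': "adjoint_pair a a'" using a by (rule adjoint_exists)
  obtain c' where c': "adjoint_pair c c'" using c by (rule adjoint_exists)
  obtain d' where d': "adjoint_pair d d'" using d by (rule adjoint_exists)
  have comm': "\<And>x. a' (c' x) = c' (a' x)" "\<And>x. a' (d' x) = d' (a' x)" "\<And>x. c' (d' x) = d' (c' x)"
    by (rule commuting_adjoints[OF a' c' comm(1)], rule commuting_adjoints[OF a' d' comm(2)],
        rule commuting_adjoints[OF c' d' comm(3)])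
  have "invertible_op (pencil a' (\<lambda>x. x) l) \<or> invertible_op (pencil c' d' l)" for l
    using cover[of "cnj l"] invertible_op_adjoint[OF adjoint_pair_pencil[OF a' adjoint_pair_id, of "cnj l"]]
      invertible_op_adjoint[OF adjoint_pair_pencil[OF c' d', of "cnj l"]] by auto
  then have "\<exists>e. bounded_below_by e (\<lambda>x. a' (d' x) - c' x)"
    using a' c' d' by (intro commuting_pencils_bounded_below comm') (auto simp: adjoint_pair_def)
  moreover have "adjoint_pair (\<lambda>x. a (d x) - c x) (\<lambda>x. a' (d' x) - c' x)"
    using adjoint_pair_minus[OF adjoint_pair_compose[OF a' d'] c'] by (simp add: comm'(2))
  ultimately show ?thesis
    using commuting_pencils_bounded_below[OF a c d comm cover] invertible_op_iff by blast
qed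

section \<open>Approximate eigenvalues\<close>

definition approx_eigenvalue :: "('a::chilbert_space \<Rightarrow> 'a) \<Rightarrow> complex \<Rightarrow> bool" where
  "approx_eigenvalue T l \<longleftrightarrow> (\<forall>e>0. \<exists>x. norm x = 1 \<and> norm (T x - l *\<^sub>C x) < e)"

lemma spectrum_iff_pencil: "l \<in> spectrum T \<longleftrightarrow> \<not> invertible_op (pencil T (\<lambda>x. x) l)"
  by (simp add: spectrum_iff pencil_def[abs_def])

lemma closed_spectrum: "bounded_clinear T \<Longrightarrow> closed (spectrum T)"
  using open_pencil_invertible[OF _ bounded_clinear_id(2), of T]
  by (simp add: closed_def Compl_eq spectrum_iff_pencil)

lemma approx_eigenvalueI:
  assumes "bounded_clinear T" "\<nexists>c. bounded_below_by c (pencil T (\<lambda>x. x) l)"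
  shows "approx_eigenvalue T l"
proof -
  obtain x where x: "\<And>n. norm (x n) = 1"
    "\<And>n. norm (pencil T (\<lambda>x. x) l (x n)) < inverse (real (Suc n))"
    using unit_vectors_of_not_bounded_below[OF bounded_clinear_pencil[OF assms(1) bounded_clinear_id(2)]
        assms(2)] by blast
  show ?thesis
    unfolding approx_eigenvalue_def
  proof (intro allI impI)
    fix e :: real assume "e > 0"
    then obtain n where "inverse (real (Suc n)) < e" using reals_Archimedean by blast
    with x[of n] show "\<exists>x. norm x = 1 \<and> norm (T x - l *\<^sub>C x) < e"
      unfolding pencil_def by (intro exI[of _ "x n"]) linarith
  qed
qed

lemma spectrum_cases:
  assumes adj: "adjoint_pair T T'" and "l \<in> spectrum T"
  shows "approx_eigenvalue T l \<or> approx_eigenvalue T' (cnj l)"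
  using assms(2) approx_eigenvalueI[of T l] approx_eigenvalueI[of T' "cnj l"] adj
    invertible_op_iff[OF adjoint_pair_pencil[OF adj adjoint_pair_id]]
  unfolding spectrum_iff_pencil adjoint_pair_def by blast

text \<open>The lower bound \<open>c\<close> at \<open>l\<close> leaves \<open>c / 2\<close> at a
  nearby \<open>m\<close>. There invertibility carries it unchanged to the adjoint, and a second
  perturbation brings it back to \<open>l\<close> as \<open>c / 4\<close>. Since that second step
  starts from \<open>c / 2\<close>, \<open>m\<close> is taken within \<open>c / 4\<close> of
  \<open>l\<close>.\<close>

lemma invertible_limit_bounded_below:
  assumes adj: "adjoint_pair T T'" and below: "bounded_below_by c (pencil T (\<lambda>x. x) l)"
    and lim: "\<And>e. e > 0 \<Longrightarrow> \<exists>m. cmod (m - l) < e \<and> invertible_op (pencil T (\<lambda>x. x) m)"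
  shows "invertible_op (pencil T (\<lambda>x. x) l)"
proof -
  note adj' = adjoint_pair_pencil[OF adj adjoint_pair_id]
  have c: "c > 0" using below by (simp add: bounded_below_by_def)
  then obtain m where m: "cmod (m - l) < c / 4" "invertible_op (pencil T (\<lambda>x. x) m)"
    using lim[of "c / 4"] by auto
  have "bounded_below_by (c / 2) (pencil T (\<lambda>x. x) m)"
    by (rule bounded_below_by_pencil_near[OF below, where K = 1]) (use m c in auto)
  then have "bounded_below_by (c / 2) (pencil T' (\<lambda>x. x) (cnj m))"
    by (rule adjoint_bounded_below[OF m(2) adj'])
  then have "bounded_below_by (c / 2 / 2) (pencil T' (\<lambda>x. x) (cnj l))"
    by (rule bounded_below_by_pencil_near[where K = 1])
      (use m in \<open>simp_all add: norm_minus_commute flip: complex_cnj_diff\<close>)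
  with below show ?thesis by (rule invertible_opI[OF adj'])
qed

text \<open>Such an \<open>l\<close> is a limit of points outside the spectrum. If
  \<open>T - l\<close> or its adjoint were bounded below, it would be invertible by
  \<open>invertible_limit_bounded_below\<close>.\<close>

lemma spectrum_boundary:
  assumes adj: "adjoint_pair T T'" and l: "l \<in> spectrum T" "l \<notin> interior (spectrum T)"
  shows "approx_eigenvalue T l \<and> approx_eigenvalue T' (cnj l)"
proof
  have bcl: "bounded_clinear T" "bounded_clinear T'" using adj by (auto simp: adjoint_pair_def)
  have near: "\<exists>m. cmod (m - l) < e \<and> invertible_op (pencil T (\<lambda>x. x) m)" if "e > 0" for e
  proof -
    have "\<not> ball l e \<subseteq> spectrum T" using l(2) that unfolding mem_interior by blast
    then show ?thesis by (auto simp: spectrum_iff_pencil dist_norm norm_minus_commute)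
  qed
  show "approx_eigenvalue T l"
    using invertible_limit_bounded_below[OF adj _ near] l(1)
    by (intro approx_eigenvalueI[OF bcl(1)]) (auto simp: spectrum_iff_pencil)
  have near': "\<exists>m. cmod (m - cnj l) < e \<and> invertible_op (pencil T' (\<lambda>x. x) m)" if e: "e > 0" for e
  proof -
    obtain m where m: "cmod (m - l) < e" "invertible_op (pencil T (\<lambda>x. x) m)"
      using near[OF e] by blast
    have "invertible_op (pencil T' (\<lambda>x. x) (cnj m))"
      by (rule invertible_op_adjoint[OF adjoint_pair_pencil[OF adj adjoint_pair_id] m(2)])
    with m(1) show ?thesis
      by (intro exI[of _ "cnj m"]) (simp flip: complex_cnj_diff)
  qed
  have "\<not> invertible_op (pencil T' (\<lambda>x. x) (cnj l))"
    using invertible_op_adjoint[OF adjoint_pair_pencil[OF adjoint_pair_sym[OF adj] adjoint_pair_id,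
        of "cnj l"]] l(1) by (auto simp: spectrum_iff_pencil)
  then show "approx_eigenvalue T' (cnj l)"
    using invertible_limit_bounded_below[OF adjoint_pair_sym[OF adj] _ near']
    by (intro approx_eigenvalueI[OF bcl(2)]) blast
qed

section \<open>Moving a pair of spectral points to the boundary\<close>

lemma exit_point:
  fixes p q :: "real \<Rightarrow> 'a::topological_space"
  assumes X: "closed X" and cont: "continuous_on UNIV p" "continuous_on UNIV q"
    and start: "p 0 \<in> X" "q 0 \<in> X" and exit: "t1 \<ge> 0" "p t1 \<notin> X"
  obtains t where "p t \<in> X" "q t \<in> X" "p t \<notin> interior X \<or> q t \<notin> interior X"
proof -
  \<comment> \<open>The times up to \<open>t1\<close> at which at least one curve is not in the
    interior. This set is closed, so its infimum is a first such time, and before it both curves run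
    in the interior.\<close>
  define Z where "Z = {0..t1} \<inter> (p -` (- interior X) \<union> q -` (- interior X))"
  have "closed Z"
    unfolding Z_def by (intro closed_Int closed_Un closed_vimage cont) (auto simp: closed_def)
  moreover have "t1 \<in> Z" using exit interior_subset[of X] by (auto simp: Z_def)
  moreover have bdd: "bdd_below Z" unfolding Z_def by (intro bdd_belowI[of _ 0]) auto
  ultimately have inZ: "Inf Z \<in> Z" using closed_contains_Inf by blast
  define t where "t = Inf Z"
  have t: "t \<ge> 0" "p t \<notin> interior X \<or> q t \<notin> interior X" "t \<le> t1"
    using inZ by (auto simp: Z_def t_def)
  have before: "{0..<t} \<subseteq> p -` X \<inter> q -` X"
  proof
    fix s assume s: "s \<in> {0..<t}"
    then have "s \<notin> Z" using cInf_lower[OF _ bdd, of s] by (auto simp: t_def)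
    then show "s \<in> p -` X \<inter> q -` X"
      using s t interior_subset[of X] by (auto simp: Z_def)
  qed
  have "p t \<in> X \<and> q t \<in> X"
  \<comment> \<open>For \<open>t > 0\<close> the points at time \<open>t\<close> are limits of
    earlier ones and \<open>X\<close> is closed. For \<open>t = 0\<close> there are no earlier ones,
    and the starting assumption takes over.\<close>
  proof (cases "t = 0")
    case False
    have "closed (p -` X \<inter> q -` X)" by (intro closed_Int closed_vimage X cont)
    from closure_minimal[OF before this] have "{0..t} \<subseteq> p -` X \<inter> q -` X"
      using False t by simp
    then show ?thesis using t(1) by auto
  qed (use start in simp)
  with t that show thesis by blast
qed

text \<open>At the exit time one of the two points has both types, so it can take whichever type the
  other point has.\<close>

lemma spectrum_pair_along_curve:
  assumes adj: "adjoint_pair T T'" and cont: "continuous_on UNIV p" "continuous_on UNIV q"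
    and start: "p 0 \<in> spectrum T" "q 0 \<in> spectrum T" and exit: "t1 \<ge> 0" "p t1 \<notin> spectrum T"
  shows "\<exists>t::real. approx_eigenvalue T (p t) \<and> approx_eigenvalue T (q t) \<or>
    approx_eigenvalue T' (cnj (p t)) \<and> approx_eigenvalue T' (cnj (q t))"
proof -
  have "closed (spectrum T)" using adj by (simp add: closed_spectrum adjoint_pair_def)
  then obtain t where "p t \<in> spectrum T" "q t \<in> spectrum T"
    "p t \<notin> interior (spectrum T) \<or> q t \<notin> interior (spectrum T)"
    using exit_point[OF _ cont start exit] by blast
  then show ?thesis
    using spectrum_boundary[OF adj] spectrum_cases[OF adj] by blast
qed

lemma spectrum_bounded:
  assumes "bounded_clinear T"
  obtains L where "L > 0" "\<And>l. L \<le> cmod l \<Longrightarrow> l \<notin> spectrum T"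
proof (rule pencil_invertible_far[OF assms])
  fix L :: real
  assume "L > 0" "\<And>l. L \<le> cmod l \<Longrightarrow> invertible_op (pencil T (\<lambda>x. x) l)"
  then show thesis by (intro that) (simp_all add: spectrum_iff_pencil)
qed

lemma spectrum_pair_sum:
  assumes adj: "adjoint_pair T T'" and l: "l \<in> spectrum T" and m: "m \<in> spectrum T"
  obtains l' m' where "l' + m' = l + m"
    "approx_eigenvalue T l' \<and> approx_eigenvalue T m' \<or>
     approx_eigenvalue T' (cnj l') \<and> approx_eigenvalue T' (cnj m')"
proof -
  have "bounded_clinear T" using adj by (simp add: adjoint_pair_def)
  then obtain L where L: "L > 0" "\<And>l. L \<le> cmod l \<Longrightarrow> l \<notin> spectrum T"
    by (rule spectrum_bounded) blast
  \<comment> \<open>A displacement by \<open>cmod l + L\<close> reaches modulus at least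
    \<open>L\<close>, wherever \<open>l\<close> lies in the plane.\<close>
  have "cmod (complex_of_real (cmod l + L)) \<le> cmod (l + complex_of_real (cmod l + L)) + cmod l"
    using norm_triangle_ineq4[of "l + complex_of_real (cmod l + L)" l] by simp
  then have exit: "l + complex_of_real (cmod l + L) \<notin> spectrum T"
    using L(1) by (intro L(2)) (simp only: norm_of_real)
  have "\<exists>t::real. approx_eigenvalue T (l + of_real t) \<and> approx_eigenvalue T (m - of_real t) \<or>
    approx_eigenvalue T' (cnj (l + of_real t)) \<and> approx_eigenvalue T' (cnj (m - of_real t))"
    by (rule spectrum_pair_along_curve[OF adj, where ?t1.0 = "cmod l + L"])
      (use l m exit L(1) in \<open>auto intro!: continuous_intros\<close>)
  then obtain t :: real where "approx_eigenvalue T (l + of_real t) \<and> approx_eigenvalue T (m - of_real t) \<or>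
    approx_eigenvalue T' (cnj (l + of_real t)) \<and> approx_eigenvalue T' (cnj (m - of_real t))" ..
  then show thesis by (rule that[rotated]) simp
qed

lemma spectrum_pair_product:
  assumes adj: "adjoint_pair T T'" and l: "l \<in> spectrum T" and m: "m \<in> spectrum T"
  obtains l' m' where "l' * m' = l * m"
    "approx_eigenvalue T l' \<and> approx_eigenvalue T m' \<or>
     approx_eigenvalue T' (cnj l') \<and> approx_eigenvalue T' (cnj m')"
proof (cases "l * m = 0")
  \<comment> \<open>Multiplication by an exponential cannot move 0. But then 0 itself is in the
    spectrum, and the pair \<open>(0, 0)\<close> has equal types and the right product.\<close>
  case True
  then have "0 \<in> spectrum T" using l m by auto
  from spectrum_cases[OF adj this] show thesis
    by (intro that[of 0 0]) (use True in auto)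
next
  case False
  then have l0: "cmod l > 0" by simp
  have "bounded_clinear T" using adj by (simp add: adjoint_pair_def)
  then obtain L where L: "L > 0" "\<And>l. L \<le> cmod l \<Longrightarrow> l \<notin> spectrum T"
    by (rule spectrum_bounded) blast
  \<comment> \<open>Since \<open>exp s \<ge> s\<close>, this time is late enough for
    \<open>l * exp s\<close> to have modulus at least \<open>L\<close>.\<close>
  define s where "s = L / cmod l"
  have s: "s > 0" using L(1) l0 by (simp add: s_def)
  have "L = s * cmod l" using l0 by (simp add: s_def)
  also have "\<dots> \<le> exp s * cmod l"
    using exp_ge_add_one_self[of s] by (intro mult_right_mono) (linarith, simp)
  also have "\<dots> = cmod (l * of_real (exp s))" by (simp add: norm_mult)
  finally have exit: "l * of_real (exp s) \<notin> spectrum T" by (rule L(2))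
  have "\<exists>t::real. approx_eigenvalue T (l * of_real (exp t)) \<and> approx_eigenvalue T (m * of_real (exp (- t))) \<or>
    approx_eigenvalue T' (cnj (l * of_real (exp t))) \<and> approx_eigenvalue T' (cnj (m * of_real (exp (- t))))"
    by (rule spectrum_pair_along_curve[OF adj, where ?t1.0 = s])
      (use l m exit s in \<open>auto intro!: continuous_intros\<close>)
  then obtain t :: real where
    "approx_eigenvalue T (l * of_real (exp t)) \<and> approx_eigenvalue T (m * of_real (exp (- t))) \<or>
    approx_eigenvalue T' (cnj (l * of_real (exp t))) \<and> approx_eigenvalue T' (cnj (m * of_real (exp (- t))))" ..
  moreover have "(l * of_real (exp t)) * (m * of_real (exp (- t))) = l * m"
    by (simp add: mult_ac exp_minus flip: of_real_mult)
  ultimately show thesis using that by blast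
qed

section \<open>Operators on the tensor square\<close>

text \<open>The densely defined operator is given by a graph relation because its values will be
  read off from representations that are not unique. The norm bound applied to differences makes the
  relation single-valued and the resulting map uniformly continuous, so it extends to the closure;
  linearity passes to limits.\<close>

lemma bounded_clinear_extension:
  fixes G :: "'a::chilbert_space \<Rightarrow> 'a \<Rightarrow> bool"
  assumes add: "\<And>x y x' y'. G x y \<Longrightarrow> G x' y' \<Longrightarrow> G (x + x') (y + y')"
    and scale: "\<And>c x y. G x y \<Longrightarrow> G (c *\<^sub>C x) (c *\<^sub>C y)"
    and bound: "\<And>x y. G x y \<Longrightarrow> norm y \<le> K * norm x" and K: "K > 0"
    and dense: "closure {x. \<exists>y. G x y} = UNIV"
  obtains T where "bounded_clinear T" "\<And>x y. G x y \<Longrightarrow> T x = y"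
proof -
  define X where "X = {x. \<exists>y. G x y}"
  define f where "f x = (SOME y. G x y)" for x
  have f: "G x (f x)" if "x \<in> X" for x
    using that unfolding X_def f_def by (auto intro: someI)
  have diff: "norm (y - y') \<le> K * norm (x - x')" if "G x y" "G x' y'" for x y x' y'
    using bound[OF add[OF that(1) scale[OF that(2), of "-1"]]]
    by (simp add: scaleC_one)
  have "uniformly_continuous_on X f"
    unfolding uniformly_continuous_on_def
  proof (intro allI impI)
    fix e :: real assume "e > 0"
    have "dist (f x') (f x) < e" if "x \<in> X" "x' \<in> X" "dist x' x < e / K" for x x'
    proof -
      have "K * dist x' x < e" using that(3) K by (simp add: field_simps)
      then show ?thesis using diff[OF f[OF that(2)] f[OF that(1)]] by (simp add: dist_norm)
    qed
    then show "\<exists>d>0. \<forall>x\<in>X. \<forall>x'\<in>X. dist x' x < d \<longrightarrow> dist (f x') (f x) < e"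
      using \<open>e > 0\<close> K by (intro exI[of _ "e / K"]) auto
  qed
  then obtain T where T: "uniformly_continuous_on (closure X) T" "\<And>x. x \<in> X \<Longrightarrow> f x = T x"
    by (rule uniformly_continuous_on_extension_on_closure) blast
  have TG: "T x = y" if "G x y" for x y
  proof -
    have "x \<in> X" using that by (auto simp: X_def)
    then show ?thesis using T(2)[of x] diff[OF that f[of x]] by simp
  qed
  have cont: "isCont T x" for x
    using uniformly_continuous_imp_continuous[OF T(1)] dense
    by (simp add: X_def continuous_on_eq_continuous_at)
  have lim: "(\<lambda>n. T (s n)) \<longlonglongrightarrow> T x" if "s \<longlonglongrightarrow> x" for s x
    by (rule isCont_tendsto_compose[OF cont that])
  have approx: "\<exists>s t. s \<longlonglongrightarrow> x \<and> t \<longlonglongrightarrow> T x \<and> (\<forall>n. G (s n) (t n))" for x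
  proof -
    obtain s where s: "\<And>n. s n \<in> X" "s \<longlonglongrightarrow> x"
      using dense closure_sequential[of x X] unfolding X_def by auto
    have "G (s n) (T (s n))" for n using f[OF s(1)] T(2)[OF s(1)] by simp
    with s(2) lim[OF s(2)] show ?thesis by blast
  qed
  have "bounded_clinear T"
  proof (rule bounded_clinearI)
    fix x y
    obtain s t where s: "s \<longlonglongrightarrow> x" "t \<longlonglongrightarrow> T x" "\<And>n. G (s n) (t n)" using approx by blast
    obtain s' t' where s': "s' \<longlonglongrightarrow> y" "t' \<longlonglongrightarrow> T y" "\<And>n. G (s' n) (t' n)" using approx by blast
    have "(\<lambda>n. T (s n + s' n)) = (\<lambda>n. t n + t' n)"
      using TG[OF add[OF s(3) s'(3)]] by simp
    then show "T (x + y) = T x + T y"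
      using lim[OF tendsto_add[OF s(1) s'(1)]] tendsto_add[OF s(2) s'(2)] LIMSEQ_unique by metis
  next
    fix c x
    obtain s t where s: "s \<longlonglongrightarrow> x" "t \<longlonglongrightarrow> T x" "\<And>n. G (s n) (t n)" using approx by blast
    have cl: "(\<lambda>n. c *\<^sub>C r n) \<longlonglongrightarrow> c *\<^sub>C y" if "r \<longlonglongrightarrow> y" for r and y :: 'a
      by (rule bounded_clinear_tendsto[OF bounded_clinear_scale[OF bounded_clinear_id(2)] that])
    have "(\<lambda>n. T (c *\<^sub>C s n)) = (\<lambda>n. c *\<^sub>C t n)"
      using TG[OF scale[OF s(3)]] by simp
    then show "T (c *\<^sub>C x) = c *\<^sub>C T x"
      using lim[OF cl[OF s(1)]] cl[OF s(2)] LIMSEQ_unique by metis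
  next
    fix x
    obtain s t where s: "s \<longlonglongrightarrow> x" "t \<longlonglongrightarrow> T x" "\<And>n. G (s n) (t n)" using approx by blast
    show "norm (T x) \<le> K * norm x"
      by (rule LIMSEQ_le[OF tendsto_norm[OF s(2)] tendsto_mult_left[OF tendsto_norm[OF s(1)]]])
        (use bound[OF s(3)] in blast)
  qed
  then show thesis using TG that by blast
qed

text \<open>Gram-Schmidt, one vector at a time: if the component \<open>w\<close> of
  \<open>v\<close> orthogonal to the span of \<open>E\<close> is nonzero, its normalisation joins
  \<open>E\<close>. The old vectors keep their expansions, because the new one is orthogonal to
  them.\<close>

lemma finite_orthonormal_expansion:
  fixes V :: "'a::chilbert_space set"
  assumes "finite V"
  shows "\<exists>E. finite E \<and> (\<forall>x\<in>E. \<forall>y\<in>E. cinner x y = (if x = y then 1 else 0)) \<and>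
    (\<forall>v\<in>V. v = (\<Sum>e\<in>E. cinner e v *\<^sub>C e))"
  using assms
proof (induction V rule: finite_induct)
  case empty
  then show ?case by (intro exI[of _ "{}"]) simp
next
  case (insert v V)
  then obtain E where E: "finite E" "\<And>x y. x \<in> E \<Longrightarrow> y \<in> E \<Longrightarrow> cinner x y = (if x = y then 1 else 0)"
    "\<And>u. u \<in> V \<Longrightarrow> u = (\<Sum>e\<in>E. cinner e u *\<^sub>C e)" by metis
  define w where "w = v - (\<Sum>e\<in>E. cinner e v *\<^sub>C e)"
  have ew: "cinner e w = 0" if "e \<in> E" for e
  proof -
    have "(\<Sum>e'\<in>E. cinner e' v * cinner e e') = (\<Sum>e'\<in>E. if e = e' then cinner e v else 0)"
      using E(2) that by (intro sum.cong) auto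
    then show ?thesis
      using that E(1) by (simp add: w_def cinner_diff_right cinner_sum_right cinner_scaleC_right)
  qed
  show ?case
  proof (cases "w = 0")
    case True
    then show ?thesis using E by (intro exI[of _ E]) (auto simp: w_def)
  next
    case False
    define e where "e = complex_of_real (inverse (norm w)) *\<^sub>C w"
    have w: "w = complex_of_real (norm w) *\<^sub>C e"
      using False by (simp add: e_def scaleC_scaleC scaleC_one flip: of_real_mult)
    have ee: "cinner e e = 1"
      using False by (simp add: e_def norm_scaleC norm_inverse cinner_self)
    have eE: "cinner e' e = 0" "cinner e e' = 0" if "e' \<in> E" for e'
      using ew[OF that] cinner_commute[of e e'] by (simp_all add: e_def cinner_scaleC_right)
    then have "e \<notin> E" using ee by force
    have ev: "cinner e v *\<^sub>C e = w"
    proof -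
      have "cinner e v = cinner e w + cinner e (\<Sum>e\<in>E. cinner e v *\<^sub>C e)"
        by (simp add: w_def flip: cinner_add_right)
      also have "\<dots> = complex_of_real (norm w)"
        by (subst w) (simp add: cinner_scaleC_right cinner_sum_right ee eE)
      finally show ?thesis using w by simp
    qed
    have "u = (\<Sum>x\<in>insert e E. cinner x u *\<^sub>C x)" if u: "u \<in> insert v V" for u
    proof (cases "u = v")
      case True
      then show ?thesis using E(1) \<open>e \<notin> E\<close> ev by (simp add: w_def)
    next
      case False
      then have *: "u = (\<Sum>x\<in>E. cinner x u *\<^sub>C x)" using u E(3) by blast
      have "cinner e u = 0"
        by (subst *) (simp add: cinner_sum_right cinner_scaleC_right eE)
      then show ?thesis using E(1) \<open>e \<notin> E\<close> * by simp
    qed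
    moreover have "\<forall>x\<in>insert e E. \<forall>y\<in>insert e E. cinner x y = (if x = y then 1 else 0)"
      using E(2) ee eE \<open>e \<notin> E\<close> by auto
    ultimately show ?thesis using E(1) by (intro exI[of _ "insert e E"]) blast
  qed
qed

lemma invertible_op_scale:
  assumes "invertible_op T" "c \<noteq> 0"
  shows "invertible_op (\<lambda>x. c *\<^sub>C T x)"
proof -
  obtain R where R: "bounded_clinear R" "\<And>x. R (T x) = x" "\<And>x. T (R x) = x"
    using assms(1) unfolding invertible_op_def by blast
  have "bounded_clinear (\<lambda>x. R (inverse c *\<^sub>C x))"
    by (rule bounded_clinear_compose[OF R(1) bounded_clinear_scale[OF bounded_clinear_id(2)]])
  moreover have "R (inverse c *\<^sub>C (c *\<^sub>C T x)) = x" "c *\<^sub>C T (R (inverse c *\<^sub>C x)) = x" for x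
    using assms(2) by (simp_all add: R scaleC_scaleC scaleC_one)
  ultimately show ?thesis unfolding invertible_op_def by blast
qed

section \<open>Construction and uniqueness of operators on the tensor product\<close>

context
  fixes tensor :: "'h::chilbert_space \<Rightarrow> 'h \<Rightarrow> 'k::chilbert_space"
  assumes tensor: "hilbert_tensor_product tensor"
begin

lemma tensor_add_left: "tensor (u + u') v = tensor u v + tensor u' v"
  and tensor_add_right: "tensor u (v + v') = tensor u v + tensor u v'"
  and tensor_scaleC_left: "tensor (c *\<^sub>C u) v = c *\<^sub>C tensor u v"
  and tensor_scaleC_right: "tensor u (c *\<^sub>C v) = c *\<^sub>C tensor u v"
  and cinner_tensor: "cinner (tensor u v) (tensor u' v') = cinner u u' * cinner v v'"
  and tensor_dense: "closure (cspan {tensor u v |u v. True}) = UNIV"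
  using tensor unfolding hilbert_tensor_product_def by blast+

lemma tensor_minus_left: "tensor (- u) v = - tensor u v"
  using tensor_scaleC_left[of "-1" u v] by (simp add: scaleC_one)

lemma tensor_minus_right: "tensor u (- v) = - tensor u v"
  using tensor_scaleC_right[of u "-1" v] by (simp add: scaleC_one)

lemma tensor_diff_left: "tensor (u - u') v = tensor u v - tensor u' v"
  by (metis tensor_add_left tensor_minus_left diff_conv_add_uminus)

lemma tensor_diff_right: "tensor u (v - v') = tensor u v - tensor u v'"
  by (metis tensor_add_right tensor_minus_right diff_conv_add_uminus)

lemma tensor_zero_left: "tensor 0 v = 0"
  using tensor_diff_left[of 0 0 v] by simp

lemma tensor_sum_right: "tensor u (sum f I) = (\<Sum>i\<in>I. tensor u (f i))"
  using tensor_diff_right[of u 0 0]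
  by (induction I rule: infinite_finite_induct) (auto simp: tensor_add_right)

lemma norm_tensor: "norm (tensor u v) = norm u * norm v"
proof -
  have "complex_of_real ((norm (tensor u v))\<^sup>2) = complex_of_real ((norm u * norm v)\<^sup>2)"
    by (simp only: cinner_self[symmetric] cinner_tensor)
      (simp add: cinner_self power_mult_distrib)
  then have "(norm (tensor u v))\<^sup>2 = (norm u * norm v)\<^sup>2"
    using of_real_eq_iff by blast
  then show ?thesis by (metis norm_ge_zero mult_nonneg_nonneg power2_eq_iff_nonneg)
qed

lemma tensor_op_unique:
  assumes T: "bounded_clinear T" and U: "bounded_clinear U"
    and eq: "\<And>u v. T (tensor u v) = U (tensor u v)"
  shows "T = U"
proof -
  have "x \<in> {x. T x = U x}" if "x \<in> cspan {tensor u v |u v. True}" for x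
    using that
  proof (induction rule: complex_vector.span_induct_alt)
    case base
    then show ?case using bounded_clinear_diff[OF T, of 0 0] bounded_clinear_diff[OF U, of 0 0] by simp
  next
    case (step c x y)
    then show ?case
      by (auto simp: bounded_clinear_add[OF T] bounded_clinear_add[OF U]
          bounded_clinear_scaleC[OF T] bounded_clinear_scaleC[OF U] eq)
  qed
  then have "cspan {tensor u v |u v. True} \<subseteq> {x. T x = U x}" by blast
  moreover have "closed {x. T x = U x}"
    by (intro closed_Collect_eq linear_continuous_on bounded_clinear_bounded_linear T U)
  ultimately have "closure (cspan {tensor u v |u v. True}) \<subseteq> {x. T x = U x}"
    by (rule closure_minimal)
  then have "UNIV \<subseteq> {x. T x = U x}" unfolding tensor_dense .
  then show ?thesis by auto
qed

text \<open>Serves to compute the adjoints of \<open>A \<otimes> I\<close> and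
  \<open>I \<otimes> A\<close> on elementary tensors.\<close>

lemma tensor_cinner_ext:
  assumes eq: "\<And>u v. cinner x (tensor u v) = cinner y (tensor u v)"
  shows "x = y"
proof -
  have "cspan {tensor u v |u v. True} \<subseteq> {z. cinner (x - y) z = 0}"
  proof
    fix z assume "z \<in> cspan {tensor u v |u v. True}"
    then show "z \<in> {z. cinner (x - y) z = 0}"
      by (induction rule: complex_vector.span_induct_alt)
        (auto simp: cinner_add_right cinner_scaleC_right cinner_diff_left eq)
  qed
  moreover have "closed {z. cinner (x - y) z = 0}"
    by (intro closed_Collect_eq continuous_intros
        linear_continuous_on[OF bounded_bilinear.bounded_linear_right[OF bounded_bilinear_cinner]])
  ultimately have "closure (cspan {tensor u v |u v. True}) \<subseteq> {z. cinner (x - y) z = 0}"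
    by (rule closure_minimal)
  then have "UNIV \<subseteq> {z. cinner (x - y) z = 0}" unfolding tensor_dense .
  then have "cinner (x - y) (x - y) = 0" by blast
  then show ?thesis by (simp add: cinner_self)
qed

text \<open>Lists of pairs play the role of formal sums of elementary tensors. Concatenation
  realises addition, and scalars are absorbed into the left factors. That different lists for the
  same vector give the same value is contained in the norm bound.\<close>

lemma tensor_op_extension:
  assumes scale: "\<And>c u v. f (c *\<^sub>C u) v = c *\<^sub>C f u v" and K: "K > 0"
    and bound: "\<And>ps. norm (\<Sum>(u, v)\<leftarrow>ps. f u v) \<le> K * norm (\<Sum>(u, v)\<leftarrow>ps. tensor u v)"
  obtains T where "bounded_clinear T" "\<And>u v. T (tensor u v) = f u v"
proof -
  define G where "G x y \<longleftrightarrow> (\<exists>ps. x = (\<Sum>(u, v)\<leftarrow>ps. tensor u v) \<and> y = (\<Sum>(u, v)\<leftarrow>ps. f u v))" for x y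
  have G: "G (tensor u v) (f u v)" for u v
    unfolding G_def by (rule exI[of _ "[(u, v)]"]) simp
  have add: "G (x + x') (y + y')" if "G x y" "G x' y'" for x y x' y'
  proof -
    from that obtain ps qs where "x = (\<Sum>(u, v)\<leftarrow>ps. tensor u v)" "y = (\<Sum>(u, v)\<leftarrow>ps. f u v)"
      "x' = (\<Sum>(u, v)\<leftarrow>qs. tensor u v)" "y' = (\<Sum>(u, v)\<leftarrow>qs. f u v)"
      unfolding G_def by blast
    then show ?thesis unfolding G_def by (intro exI[of _ "ps @ qs"]) simp
  qed
  have scaleG: "G (c *\<^sub>C x) (c *\<^sub>C y)" if "G x y" for c x y
  proof -
    from that obtain ps where ps: "x = (\<Sum>(u, v)\<leftarrow>ps. tensor u v)" "y = (\<Sum>(u, v)\<leftarrow>ps. f u v)"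
      unfolding G_def by blast
    have "c *\<^sub>C (\<Sum>(u, v)\<leftarrow>ps. tensor u v) = (\<Sum>(u, v)\<leftarrow>map (\<lambda>(u, v). (c *\<^sub>C u, v)) ps. tensor u v)"
      by (induction ps) (auto simp: scaleC_add_right tensor_scaleC_left)
    moreover have "c *\<^sub>C (\<Sum>(u, v)\<leftarrow>ps. f u v) = (\<Sum>(u, v)\<leftarrow>map (\<lambda>(u, v). (c *\<^sub>C u, v)) ps. f u v)"
      by (induction ps) (auto simp: scaleC_add_right scale)
    ultimately show ?thesis unfolding G_def ps by blast
  qed
  have "z \<in> {x. \<exists>y. G x y}" if "z \<in> cspan {tensor u v |u v. True}" for z
    using that
  proof (induction rule: complex_vector.span_induct_alt)
    case base
    show ?case unfolding G_def by (auto intro: exI[of _ "[]"])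
  next
    case (step c x y)
    then show ?case using add[OF scaleG[OF G]] by blast
  qed
  then have "closure (cspan {tensor u v |u v. True}) \<subseteq> closure {x. \<exists>y. G x y}"
    by (intro closure_mono) blast
  then have dense: "closure {x. \<exists>y. G x y} = UNIV" using tensor_dense by auto
  have boundG: "norm y \<le> K * norm x" if "G x y" for x y
    using that bound unfolding G_def by blast
  show thesis
  proof (rule bounded_clinear_extension[OF add scaleG boundG K dense])
    fix T :: "'k \<Rightarrow> 'k"
    assume T: "bounded_clinear T" "\<And>x y. G x y \<Longrightarrow> T x = y"
    from T(1) T(2)[OF G] show thesis by (rule that)
  qed
qed

text \<open>Expanding the right factors in a finite orthonormal set \<open>E\<close> turns a sum of
  tensors into a sum of \<open>w e \<otimes> e\<close>, whose squared norm is the sum of the squares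
  of \<open>norm (w e)\<close>. The operator acts on each \<open>w e\<close> separately, so the
  bound \<open>K\<close> of \<open>A\<close> carries over.\<close>

lemma tensor_op_left_exists:
  assumes A: "bounded_clinear A"
  obtains T where "bounded_clinear T" "\<And>u v. T (tensor u v) = tensor (A u) v"
proof -
  obtain K where K: "K > 0" "\<And>x. norm (A x) \<le> K * norm x"
    using A by (rule bounded_clinear_bound) blast
  \<comment> \<open>Stated for an arbitrary \<open>B\<close> because it is needed both for
    \<open>A\<close> and for the identity, with the same \<open>E\<close>.\<close>
  have expand: "(\<Sum>(u, v)\<leftarrow>ps. tensor (B u) v)
      = (\<Sum>e\<in>E. tensor (B (\<Sum>(u, v)\<leftarrow>ps. cinner e v *\<^sub>C u)) e)"
    if B: "bounded_clinear B" and E: "\<And>v. v \<in> snd ` set ps \<Longrightarrow> v = (\<Sum>e\<in>E. cinner e v *\<^sub>C e)"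
    for B :: "'h \<Rightarrow> 'h" and ps E
    using E
  proof (induction ps)
    case Nil
    then show ?case using bounded_clinear_diff[OF B, of 0 0] by (simp add: tensor_zero_left)
  next
    case (Cons p ps)
    obtain u v where p: "p = (u, v)" by force
    have "tensor (B u) v = (\<Sum>e\<in>E. tensor (B (cinner e v *\<^sub>C u)) e)"
      by (subst Cons.prems[of v])
        (simp_all add: p tensor_sum_right tensor_scaleC_right tensor_scaleC_left bounded_clinear_scaleC[OF B])
    moreover have "(\<Sum>(u, v)\<leftarrow>ps. tensor (B u) v)
        = (\<Sum>e\<in>E. tensor (B (\<Sum>(u, v)\<leftarrow>ps. cinner e v *\<^sub>C u)) e)"
      using Cons by simp
    ultimately show ?case
      by (simp add: p bounded_clinear_add[OF B] tensor_add_left sum.distrib)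
  qed
  have norm_expand: "(norm (\<Sum>e\<in>E. tensor (w e) e))\<^sup>2 = (\<Sum>e\<in>E. (norm (w e))\<^sup>2)"
    if E: "finite E" "\<forall>x\<in>E. \<forall>y\<in>E. cinner x y = (if x = y then 1 else 0)" for w and E :: "'h set"
  proof -
    have "cinner (\<Sum>e\<in>E. tensor (w e) e) (\<Sum>e\<in>E. tensor (w e) e)
      = (\<Sum>e\<in>E. \<Sum>e'\<in>E. if e = e' then cinner (w e) (w e) else 0)"
      unfolding cinner_sum_left cinner_sum_right cinner_tensor
      using E(2) by (intro sum.cong refl) auto
    also have "\<dots> = (\<Sum>e\<in>E. cinner (w e) (w e))" using E(1) by simp
    finally show ?thesis by (simp only: Re_cinner_self[symmetric] Re_sum)
  qed
  have "norm (\<Sum>(u, v)\<leftarrow>ps. tensor (A u) v) \<le> K * norm (\<Sum>(u, v)\<leftarrow>ps. tensor u v)" for ps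
  proof -
    have "finite (snd ` set ps)" by simp
    from finite_orthonormal_expansion[OF this]
    obtain E where E: "finite E" "\<forall>x\<in>E. \<forall>y\<in>E. cinner x y = (if x = y then 1 else 0)"
      and exp: "\<forall>v\<in>snd ` set ps. v = (\<Sum>e\<in>E. cinner e v *\<^sub>C e)"
      by (elim exE conjE)
    have expandE: "(\<Sum>(u, v)\<leftarrow>ps. tensor (B u) v)
        = (\<Sum>e\<in>E. tensor (B (\<Sum>(u, v)\<leftarrow>ps. cinner e v *\<^sub>C u)) e)"
      if "bounded_clinear B" for B
      using that by (rule expand) (rule bspec[OF exp])
    have "(norm (\<Sum>(u, v)\<leftarrow>ps. tensor (A u) v))\<^sup>2
        = (\<Sum>e\<in>E. (norm (A (\<Sum>(u, v)\<leftarrow>ps. cinner e v *\<^sub>C u)))\<^sup>2)"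
      unfolding expandE[OF A] by (rule norm_expand[OF E(1,2)])
    also have "\<dots> \<le> (\<Sum>e\<in>E. K\<^sup>2 * (norm (\<Sum>(u, v)\<leftarrow>ps. cinner e v *\<^sub>C u))\<^sup>2)"
      unfolding power_mult_distrib[symmetric] by (intro sum_mono power_mono K(2)) simp
    also have "\<dots> = (K * norm (\<Sum>(u, v)\<leftarrow>ps. tensor u v))\<^sup>2"
      unfolding expandE[OF bounded_clinear_id(2)] power_mult_distrib norm_expand[OF E(1,2)]
      by (simp add: sum_distrib_left)
    finally show ?thesis using K(1) by (simp add: power2_le_iff_abs_le)
  qed
  note bound = this
  have scale: "tensor (A (c *\<^sub>C u)) v = c *\<^sub>C tensor (A u) v" for c u v
    by (simp add: bounded_clinear_scaleC[OF A] tensor_scaleC_left)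
  show thesis
    by (rule tensor_op_extension[of "\<lambda>u v. tensor (A u) v", OF scale K(1) bound]) (rule that)
qed

text \<open>Exchanging the factors preserves inner products of elementary tensors, hence of finite
  sums of them, so the norm bound holds with constant 1.\<close>

lemma tensor_flip_exists:
  obtains F where "bounded_clinear F" "\<And>u v. F (tensor u v) = tensor v u"
proof -
  have 1: "cinner (tensor v u) (\<Sum>(u, v)\<leftarrow>qs. tensor v u) = cinner (tensor u v) (\<Sum>(u, v)\<leftarrow>qs. tensor u v)"
    for u v qs
    by (induction qs) (auto simp: cinner_add_right cinner_tensor)
  have 2: "cinner (\<Sum>(u, v)\<leftarrow>ps. tensor v u) (\<Sum>(u, v)\<leftarrow>qs. tensor v u)
    = cinner (\<Sum>(u, v)\<leftarrow>ps. tensor u v) (\<Sum>(u, v)\<leftarrow>qs. tensor u v)" for ps qs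
    by (induction ps) (auto simp: cinner_add_left 1)
  have "(norm (\<Sum>(u, v)\<leftarrow>ps. tensor v u))\<^sup>2 = (norm (\<Sum>(u, v)\<leftarrow>ps. tensor u v))\<^sup>2" for ps
    by (simp only: Re_cinner_self[symmetric] 2)
  then have "norm (\<Sum>(u, v)\<leftarrow>ps. tensor v u) \<le> 1 * norm (\<Sum>(u, v)\<leftarrow>ps. tensor u v)" for ps
    by (simp add: power2_eq_iff_nonneg)
  note bound = this
  show thesis
    by (rule tensor_op_extension[of "\<lambda>u v. tensor v u", OF tensor_scaleC_right zero_less_one bound])
      (rule that)
qed

lemma tensor_op_eqI:
  assumes "bounded_clinear T" "\<And>u v. T (tensor u v) = tensor (A u) (B v)"
  shows "tensor_op tensor A B = T"
  unfolding tensor_op_def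
proof (rule the_equality)
  fix U assume U: "bounded_clinear U \<and> (\<forall>u v. U (tensor u v) = tensor (A u) (B v))"
  show "U = T"
    by (rule tensor_op_unique[OF conjunct1[OF U] assms(1)]) (simp add: U assms(2))
qed (simp add: assms)

lemma tensor_flip_eqI:
  assumes "bounded_clinear F" "\<And>u v. F (tensor u v) = tensor v u"
  shows "tensor_flip tensor = F"
  unfolding tensor_flip_def
proof (rule the_equality)
  fix U assume U: "bounded_clinear U \<and> (\<forall>u v. U (tensor u v) = tensor v u)"
  show "U = F"
    by (rule tensor_op_unique[OF conjunct1[OF U] assms(1)]) (simp add: U assms(2))
qed (simp add: assms)

section \<open>Inverses and approximate eigenvectors on the tensor product\<close>

lemma invertible_opI_tensor:
  assumes "bounded_clinear T" "bounded_clinear R"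
    and "\<And>u v. R (T (tensor u v)) = tensor u v" "\<And>u v. T (R (tensor u v)) = tensor u v"
  shows "invertible_op T"
proof -
  have "(\<lambda>x. R (T x)) = (\<lambda>x. x)" "(\<lambda>x. T (R x)) = (\<lambda>x. x)"
    by (rule tensor_op_unique[OF bounded_clinear_compose[OF assms(2,1)] bounded_clinear_id(2)], fact)
      (rule tensor_op_unique[OF bounded_clinear_compose[OF assms(1,2)] bounded_clinear_id(2)], fact)
  with assms(2) show ?thesis unfolding invertible_op_def by metis
qed

lemma pencil_invertible_tensor_left:
  assumes A: "bounded_clinear A" and a: "bounded_clinear a"
    and a_tensor: "\<And>u v. a (tensor u v) = tensor (A u) v" and l: "l \<notin> spectrum A"
  shows "invertible_op (pencil a (\<lambda>x. x) l)"
proof -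
  have inv: "invertible_op (pencil A (\<lambda>x. x) l)" using l by (simp add: spectrum_iff_pencil)
  note R = invertible_op_inv[OF inv]
  obtain r where r: "bounded_clinear r" "\<And>u v. r (tensor u v) = tensor (inv (pencil A (\<lambda>x. x) l) u) v"
    using R(1) by (rule tensor_op_left_exists) blast
  have "pencil a (\<lambda>x. x) l (tensor u v) = tensor (pencil A (\<lambda>x. x) l u) v" for u v
    by (simp add: pencil_def a_tensor tensor_diff_left tensor_scaleC_left)
  then show ?thesis
    by (intro invertible_opI_tensor[OF bounded_clinear_pencil[OF a bounded_clinear_id(2)] r(1)])
      (simp_all add: r(2) R(2,3))
qed

text \<open>The inverse is \<open>I \<otimes> (A - l)^-1\<close>, obtained by conjugating the
  operator on the left factor with the flip.\<close>

lemma pencil_invertible_tensor_right: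
  assumes A: "bounded_clinear A" and b: "bounded_clinear b"
    and b_tensor: "\<And>u v. b (tensor u v) = tensor u (A v)" and l: "l \<notin> spectrum A"
  shows "invertible_op (pencil b (\<lambda>x. x) l)"
proof -
  have inv: "invertible_op (pencil A (\<lambda>x. x) l)" using l by (simp add: spectrum_iff_pencil)
  note R = invertible_op_inv[OF inv]
  obtain r where r: "bounded_clinear r" "\<And>u v. r (tensor u v) = tensor (inv (pencil A (\<lambda>x. x) l) u) v"
    using R(1) by (rule tensor_op_left_exists) blast
  obtain F where F: "bounded_clinear F" "\<And>u v. F (tensor u v) = tensor v u"
    by (rule tensor_flip_exists) blast
  have r': "bounded_clinear (\<lambda>x. F (r (F x)))"
    by (rule bounded_clinear_compose[OF F(1) bounded_clinear_compose[OF r(1) F(1)]])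
  have "pencil b (\<lambda>x. x) l (tensor u v) = tensor u (pencil A (\<lambda>x. x) l v)" for u v
    by (simp add: pencil_def b_tensor tensor_diff_right tensor_scaleC_right)
  then show ?thesis
    by (intro invertible_opI_tensor[OF bounded_clinear_pencil[OF b bounded_clinear_id(2)] r'])
      (simp_all add: r(2) R(2,3) F(2))
qed

text \<open>The cross term of the squared norm is twice \<open>|<u, v>|^2\<close>, so the
  symmetrised tensor stays away from 0 even though it is not normalised.\<close>

lemma norm_symmetrized_ge_1:
  assumes "norm u = 1" "norm v = 1"
  shows "norm (tensor u v + tensor v u) \<ge> 1"
proof -
  have "cinner (tensor u v) (tensor v u) = cinner u v * cnj (cinner u v)"
    unfolding cinner_tensor by (metis cinner_commute)
  then have "Re (cinner (tensor u v) (tensor v u)) = (cmod (cinner u v))\<^sup>2"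
    by (simp flip: complex_norm_square)
  then have "(norm (tensor u v + tensor v u))\<^sup>2 \<ge> 1"
    using assms by (simp add: power2_norm_add norm_tensor)
  then show ?thesis by (intro power2_le_imp_le[of 1]) simp_all
qed

text \<open>The scalar parts of both summands give the same factor \<open>1/2 * (l + m)\<close>;
  what remains are four tensors with a residual \<open>p\<close> or \<open>q\<close> as one factor.
  The operators are parameters so that the result also applies to the adjoints.\<close>

lemma symmetric_approx_eigenvector_sum:
  assumes T: "bounded_clinear T"
    and T_tensor: "\<And>u v. T (tensor u v) = (1/2) *\<^sub>C (tensor (A u) v + tensor u (A v))"
    and l: "approx_eigenvalue A l" and m: "approx_eigenvalue A m" and e: "e > 0"
  obtains u v where "norm (tensor u v + tensor v u) \<ge> 1"
    "norm (T (tensor u v + tensor v u) - (1/2 * (l + m)) *\<^sub>C (tensor u v + tensor v u)) < e"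
proof -
  obtain u where u: "norm u = 1" "norm (A u - l *\<^sub>C u) < e / 2"
    using l e unfolding approx_eigenvalue_def by (meson half_gt_zero)
  obtain v where v: "norm v = 1" "norm (A v - m *\<^sub>C v) < e / 2"
    using m e unfolding approx_eigenvalue_def by (meson half_gt_zero)
  define p q where "p = A u - l *\<^sub>C u" and "q = A v - m *\<^sub>C v"
  have Au: "A u = p + l *\<^sub>C u" and Av: "A v = q + m *\<^sub>C v" by (simp_all add: p_def q_def)
  have "T (tensor u v + tensor v u) - (1/2 * (l + m)) *\<^sub>C (tensor u v + tensor v u)
    = (1/2) *\<^sub>C (tensor p v + tensor u q + (tensor q u + tensor v p))"
    by (simp add: bounded_clinear_add[OF T] T_tensor Au Av tensor_add_left tensor_add_right
        tensor_scaleC_left tensor_scaleC_right scaleC_add_right scaleC_scaleC scaleC_add_left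
        distrib_left add_divide_distrib algebra_simps)
  also have "norm \<dots> \<le> 1/2 * (norm p + norm q + (norm q + norm p))"
    unfolding norm_scaleC using u(1) v(1)
    by (intro mult_mono norm_triangle_mono) (auto simp: norm_tensor)
  also have "\<dots> < e" using u(2) v(2) by (simp add: p_def q_def)
  finally show thesis using that norm_symmetrized_ge_1[OF u(1) v(1)] by blast
qed

text \<open>On \<open>u \<otimes> v\<close> the error is
  \<open>p \<otimes> A v + l (u \<otimes> q)\<close> with the residuals \<open>p\<close> and
  \<open>q\<close>; the other summand is its mirror image.\<close>

lemma symmetric_approx_eigenvector_product:
  assumes A: "bounded_clinear A" and T: "bounded_clinear T"
    and T_tensor: "\<And>u v. T (tensor u v) = tensor (A u) (A v)"
    and l: "approx_eigenvalue A l" and m: "approx_eigenvalue A m" and e: "e > 0"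
  obtains u v where "norm (tensor u v + tensor v u) \<ge> 1"
    "norm (T (tensor u v + tensor v u) - (l * m) *\<^sub>C (tensor u v + tensor v u)) < e"
proof -
  obtain K where K: "K > 0" "\<And>x. norm (A x) \<le> K * norm x"
    using A by (rule bounded_clinear_bound) blast
  \<comment> \<open>Each of the two mirrored errors is below \<open>(K + cmod l) * d\<close>, which
    this choice makes equal to \<open>e / 2\<close>.\<close>
  define d where "d = e / 2 / (K + cmod l)"
  have Kl: "K + cmod l > 0" using K(1) by (simp add: add_pos_nonneg)
  then have d: "d > 0" using e by (simp add: d_def)
  obtain u where u: "norm u = 1" "norm (A u - l *\<^sub>C u) < d"
    using l d unfolding approx_eigenvalue_def by meson
  obtain v where v: "norm v = 1" "norm (A v - m *\<^sub>C v) < d"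
    using m d unfolding approx_eigenvalue_def by meson
  define p q where "p = A u - l *\<^sub>C u" and "q = A v - m *\<^sub>C v"
  have Au: "A u = p + l *\<^sub>C u" and Av: "A v = q + m *\<^sub>C v" by (simp_all add: p_def q_def)
  have AvK: "norm (A v) \<le> K" using K(2)[of v] v(1) by simp
  have "T (tensor u v + tensor v u) - (l * m) *\<^sub>C (tensor u v + tensor v u)
    = (tensor p (A v) + l *\<^sub>C tensor u q) + (tensor (A v) p + l *\<^sub>C tensor q u)"
    by (simp add: bounded_clinear_add[OF T] T_tensor Au Av tensor_add_left tensor_add_right
        tensor_scaleC_left tensor_scaleC_right scaleC_add_right scaleC_scaleC algebra_simps)
  also have "norm \<dots> \<le> (norm p * K + cmod l * norm q) + (K * norm p + cmod l * norm q)"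
    using u(1) v(1) AvK K(1)
    by (intro norm_triangle_mono) (auto simp: norm_tensor norm_scaleC intro!: mult_mono)
  also have "\<dots> = 2 * (K * norm p + cmod l * norm q)" by simp
  also have "\<dots> < 2 * ((K + cmod l) * d)"
  proof -
    have "K * norm p < K * d" using K(1) u(2) by (simp add: p_def)
    moreover have "cmod l * norm q \<le> cmod l * d"
      using v(2) by (intro mult_left_mono) (auto simp: q_def)
    ultimately show ?thesis by (simp add: distrib_right)
  qed
  also have "\<dots> = e"
  proof -
    have "K + cmod l \<noteq> 0" using Kl by linarith
    from iffD1[OF nonzero_eq_divide_eq[OF this] d_def] show ?thesis
      by (simp add: mult.commute[of "K + cmod l"])
  qed
  finally show thesis using that norm_symmetrized_ge_1[OF u(1) v(1)] by blast
qed

end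

section \<open>Restriction to the fixed space of the flip\<close>

lemma not_in_spectrum_on_fixed_space:
  assumes F: "bounded_clinear F" and comm: "\<And>x. T (F x) = F (T x)"
    and inv: "invertible_op (\<lambda>x. T x - z *\<^sub>C x)"
  shows "z \<notin> spectrum_on {x. F x = x} (restrict T {x. F x = x})"
proof -
  obtain R where R: "bounded_clinear R" "\<And>x. R (T x - z *\<^sub>C x) = x" "\<And>x. T (R x) - z *\<^sub>C R x = x"
    using inv unfolding invertible_op_def by blast
  have RF: "F (R x) = R (F x)" for x
  proof -
    have "F (R x) = R (F (T (R x) - z *\<^sub>C R x))"
      using R(2)[of "F (R x)"] by (simp add: comm bounded_clinear_diff[OF F] bounded_clinear_scaleC[OF F])
    then show ?thesis by (simp only: R(3))
  qed
  have "bounded_clinear_on {x. F x = x} R"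
    using R(1) RF unfolding bounded_clinear_on_def by auto
  then show ?thesis
    unfolding spectrum_on_def using R RF by auto
qed

text \<open>An inverse \<open>R\<close> of the restriction is refuted in both cases without forming
  an adjoint on the subspace: \<open>T'\<close> acts on the whole space, and its residual at
  \<open>w\<close> is paired with \<open>R w\<close>, which lies in the subspace. The condition
  \<open>norm w \<ge> 1\<close> fits the symmetrised tensors, which are not unit vectors.\<close>

lemma in_spectrum_on_fixed_space:
  fixes T :: "'a::chilbert_space \<Rightarrow> 'a"
  assumes F: "bounded_clinear F" and comm: "\<And>x. T (F x) = F (T x)" and adj: "adjoint_pair T T'"
    and approx: "(\<forall>e>0. \<exists>w. F w = w \<and> norm w \<ge> 1 \<and> norm (T w - z *\<^sub>C w) < e) \<or>
      (\<forall>e>0. \<exists>w. F w = w \<and> norm w \<ge> 1 \<and> norm (T' w - cnj z *\<^sub>C w) < e)"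
  shows "z \<in> spectrum_on {x. F x = x} (restrict T {x. F x = x})"
proof (rule ccontr)
  assume "z \<notin> spectrum_on {x. F x = x} (restrict T {x. F x = x})"
  then obtain R where bR: "bounded_clinear_on {x. F x = x} R"
    and R: "\<And>x. F x = x \<Longrightarrow> R (T x - z *\<^sub>C x) = x"
      "\<And>x. F x = x \<Longrightarrow> restrict T {x. F x = x} (R x) - z *\<^sub>C R x = x"
    unfolding spectrum_on_def by auto
  have RS: "F (R x) = R x" if "F x = x" for x
    using bR that unfolding bounded_clinear_on_def by auto
  have TR: "T (R x) - z *\<^sub>C R x = x" if "F x = x" for x
    using R(2)[OF that] RS[OF that] by simp
  obtain K0 where K0: "\<And>x. F x = x \<Longrightarrow> norm (R x) \<le> K0 * norm x"
    using bR unfolding bounded_clinear_on_def by auto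
  define K where "K = max K0 1"
  have K: "K > 0" "norm (R x) \<le> K * norm x" if "F x = x" for x
    using K0[OF that] mult_right_mono[of K0 K "norm x"] by (auto simp: K_def)
  have K_pos: "1 / K > 0" by (simp add: K_def)
  from approx show False
  proof
    assume "\<forall>e>0. \<exists>w. F w = w \<and> norm w \<ge> 1 \<and> norm (T w - z *\<^sub>C w) < e"
    then obtain w where w: "F w = w" "norm w \<ge> 1" "norm (T w - z *\<^sub>C w) < 1 / K"
      using K_pos by blast
    have "F (T w - z *\<^sub>C w) = T w - z *\<^sub>C w"
      using comm[of w] by (simp add: bounded_clinear_diff[OF F] bounded_clinear_scaleC[OF F] w(1))
    then have "norm w \<le> K * norm (T w - z *\<^sub>C w)"
      using K(2)[of "T w - z *\<^sub>C w"] R(1)[OF w(1)] by simp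
    then show False using w(2,3) K(1)[OF w(1)] by (simp add: field_simps)
  next
    assume "\<forall>e>0. \<exists>w. F w = w \<and> norm w \<ge> 1 \<and> norm (T' w - cnj z *\<^sub>C w) < e"
    then obtain w where w: "F w = w" "norm w \<ge> 1" "norm (T' w - cnj z *\<^sub>C w) < 1 / K"
      using K_pos by blast
    \<comment> \<open>Moving \<open>T'\<close> across puts \<open>T - z\<close> on
      \<open>R w\<close>, which returns \<open>w\<close>. So the pairing equals
      \<open>(norm w)\<^sup>2\<close>, while the small residual makes it smaller than
      \<open>norm w\<close>.\<close>
    have "cinner (T' w - cnj z *\<^sub>C w) (R w) = cinner w (T (R w) - z *\<^sub>C R w)"
      using adj by (simp add: adjoint_pair_def cinner_diff_left cinner_diff_right
          cinner_scaleC_left cinner_scaleC_right)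
    then have "(norm w)\<^sup>2 = Re (cinner (T' w - cnj z *\<^sub>C w) (R w))"
      by (simp add: TR[OF w(1)] Re_cinner_self)
    also have "\<dots> \<le> norm (T' w - cnj z *\<^sub>C w) * norm (R w)"
      using complex_Re_le_cmod cinner_cauchy_schwarz order_trans by blast
    also have "\<dots> \<le> norm (T' w - cnj z *\<^sub>C w) * (K * norm w)"
      by (rule mult_left_mono[OF K(2)[OF w(1)]]) simp
    also have "\<dots> < 1 / K * (K * norm w)"
      using w K(1)[OF w(1)] by (intro mult_strict_right_mono mult_pos_pos) auto
    also have "\<dots> = norm w" using K(1)[OF w(1)] by simp
    finally have "norm w * norm w < 1 * norm w" by (simp add: power2_eq_square)
    then have "norm w < 1" by (rule mult_right_less_imp_less) simp
    then show False using w(2) by simp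
  qed
qed

theorem theorem6p3:
  fixes tensor :: "'h::chilbert_space \<Rightarrow> 'h \<Rightarrow> 'k::chilbert_space"
    and A :: "'h \<Rightarrow> 'h"
  assumes "hilbert_tensor_product tensor"
    and "\<exists>B :: 'h set. countable B \<and> orthonormal_basis B"
    and "bounded_clinear A"
  shows "spectrum_on (sym_tensor_space tensor) (sym_tensor_op tensor A id) =
           {(1/2) * (l + m) |l m. l \<in> spectrum A \<and> m \<in> spectrum A} \<and>
         spectrum_on (sym_tensor_space tensor) (sym_tensor_op tensor A A) =
           {l * m |l m. l \<in> spectrum A \<and> m \<in> spectrum A}"
proof
  note tensor = assms(1) and A = assms(3)
  obtain F where F: "bounded_clinear F" "\<And>u v. F (tensor u v) = tensor v u"
    using tensor_flip_exists[OF tensor] by blast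
  obtain a where a: "bounded_clinear a" "\<And>u v. a (tensor u v) = tensor (A u) v"
    using tensor_op_left_exists[OF tensor A] by blast
  \<comment> \<open>Obtaining \<open>I \<otimes> A\<close> by conjugating with the flip makes the
    exchange rules \<open>F a = b F\<close> and \<open>F b = a F\<close> immediate.\<close>
  define b where "b x = F (a (F x))" for x
  have b: "bounded_clinear b" "\<And>u v. b (tensor u v) = tensor u (A v)"
    unfolding b_def[abs_def]
    by (rule bounded_clinear_compose[OF F(1) bounded_clinear_compose[OF a(1) F(1)]])
      (simp add: F(2) a(2))
  note eq = tensor_op_unique[OF tensor, THEN fun_cong]
  note comp = bounded_clinear_compose
  have FF: "F (F x) = x" for x
    by (rule eq[OF comp[OF F(1) F(1)] bounded_clinear_id(2)]) (simp add: F(2))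
  have ab: "a (b x) = b (a x)" for x
    by (rule eq[OF comp[OF a(1) b(1)] comp[OF b(1) a(1)]]) (simp add: a(2) b(2))
  have Fa: "F (a x) = b (F x)" and Fb: "F (b x) = a (F x)" for x
    by (simp_all add: b_def FF)
  obtain A' where A': "adjoint_pair A A'" using A by (rule adjoint_exists)
  then have bA': "bounded_clinear A'" and cinA: "\<And>x y. cinner (A' x) y = cinner x (A y)"
    by (auto simp: adjoint_pair_def)
  obtain a' where a': "adjoint_pair a a'" using a(1) by (rule adjoint_exists)
  obtain b' where b': "adjoint_pair b b'" using b(1) by (rule adjoint_exists)
  \<comment> \<open>The adjoint of \<open>A \<otimes> I\<close> is \<open>A' \<otimes> I\<close>.
    This gives the adjoint of \<open>T\<close> the tensor form that the approximate eigenvector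
    lemmas require.\<close>
  have a'_tensor: "a' (tensor u v) = tensor (A' u) v" for u v
    using a' by (intro tensor_cinner_ext[OF tensor])
      (simp add: adjoint_pair_def a(2) cinner_tensor[OF tensor] cinA)
  have b'_tensor: "b' (tensor u v) = tensor u (A' v)" for u v
    using b' by (intro tensor_cinner_ext[OF tensor])
      (simp add: adjoint_pair_def b(2) cinner_tensor[OF tensor] cinA)
  have S: "sym_tensor_space tensor = {x. F x = x}"
    by (simp add: sym_tensor_space_def tensor_flip_eqI[OF tensor F])
  have FS: "F (tensor u v + tensor v u) = tensor u v + tensor v u" for u v
    by (simp add: bounded_clinear_add[OF F(1)] F(2) add.commute)
  have inv_a: "l \<notin> spectrum A \<Longrightarrow> invertible_op (pencil a (\<lambda>x. x) l)" for l
    by (rule pencil_invertible_tensor_left[OF tensor A a])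
  have inv_b: "l \<notin> spectrum A \<Longrightarrow> invertible_op (pencil b (\<lambda>x. x) l)" for l
    by (rule pencil_invertible_tensor_right[OF tensor A b])

  show "spectrum_on (sym_tensor_space tensor) (sym_tensor_op tensor A id) =
    {(1/2) * (l + m) |l m. l \<in> spectrum A \<and> m \<in> spectrum A}"
  proof -
    define T where "T x = (1/2) *\<^sub>C (a x + b x)" for x
    have T: "bounded_clinear T"
      unfolding T_def[abs_def] by (rule bounded_clinear_scale[OF bounded_clinear_plus[OF a(1) b(1)]])
    have TF: "T (F x) = F (T x)" for x
      by (simp add: T_def bounded_clinear_scaleC[OF F(1)] bounded_clinear_add[OF F(1)] Fa Fb add.commute)
    define T' where "T' x = (1/2) *\<^sub>C (a' x + b' x)" for x
    have adj: "adjoint_pair T T'"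
      using adjoint_pair_scale[OF adjoint_pair_plus[OF a' b'], of "1/2"]
      by (simp add: T_def[abs_def] T'_def[abs_def])
    then have T': "bounded_clinear T'" by (simp add: adjoint_pair_def)
    have op: "sym_tensor_op tensor A id = restrict T {x. F x = x}"
      using tensor_op_eqI[OF tensor a(1), of A id] tensor_op_eqI[OF tensor b(1), of id A]
      by (simp add: sym_tensor_op_def S a(2) b(2) T_def[abs_def])
    have "z \<in> spectrum_on {x. F x = x} (restrict T {x. F x = x})"
      if lm: "l \<in> spectrum A" "m \<in> spectrum A" "z = 1/2 * (l + m)" for z l m
    proof -
      obtain l' m' where l': "l' + m' = l + m" and
        "approx_eigenvalue A l' \<and> approx_eigenvalue A m' \<or>
         approx_eigenvalue A' (cnj l') \<and> approx_eigenvalue A' (cnj m')"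
        using spectrum_pair_sum[OF A' lm(1,2)] by blast
      then show ?thesis
      proof (elim disjE conjE)
        assume ap: "approx_eigenvalue A l'" "approx_eigenvalue A m'"
        have "\<exists>w. F w = w \<and> norm w \<ge> 1 \<and> norm (T w - z *\<^sub>C w) < e" if "e > 0" for e
          using symmetric_approx_eigenvector_sum[OF tensor T _ ap that] FS
          unfolding l' lm(3) by (metis T_def a(2) b(2))
        then show ?thesis using in_spectrum_on_fixed_space[OF F(1) TF adj] by blast
      next
        assume ap: "approx_eigenvalue A' (cnj l')" "approx_eigenvalue A' (cnj m')"
        have z: "cnj z = 1/2 * (cnj l' + cnj m')" by (simp add: lm(3) flip: l')
        have "\<exists>w. F w = w \<and> norm w \<ge> 1 \<and> norm (T' w - cnj z *\<^sub>C w) < e" if "e > 0" for e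
          using symmetric_approx_eigenvector_sum[OF tensor T' _ ap that] FS
          unfolding z by (metis T'_def a'_tensor b'_tensor)
        then show ?thesis using in_spectrum_on_fixed_space[OF F(1) TF adj] by blast
      qed
    qed
    moreover have "\<exists>l m. z = 1/2 * (l + m) \<and> l \<in> spectrum A \<and> m \<in> spectrum A"
      if z: "z \<in> spectrum_on {x. F x = x} (restrict T {x. F x = x})" for z
    proof (rule ccontr)
      assume none: "\<nexists>l m. z = 1/2 * (l + m) \<and> l \<in> spectrum A \<and> m \<in> spectrum A"
      define c where "c x = b x - (2 * z) *\<^sub>C x" for x
      define d :: "'k \<Rightarrow> 'k" where "d x = (-1) *\<^sub>C x" for x
      have c: "bounded_clinear c" and d: "bounded_clinear d"
        unfolding c_def[abs_def] d_def[abs_def]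
        by (intro bounded_clinear_minus_op b(1) bounded_clinear_scale bounded_clinear_id)+
      have comm: "a (c x) = c (a x)" "a (d x) = d (a x)" "c (d x) = d (c x)" for x
        by (simp_all add: c_def d_def ab bounded_clinear_minus[OF a(1)] bounded_clinear_minus[OF b(1)]
            bounded_clinear_diff[OF a(1)] bounded_clinear_scaleC[OF a(1)]
            bounded_clinear_scaleC[OF b(1)] scaleC_scaleC complex_vector.scale_right_diff_distrib mult.commute)
      have "invertible_op (pencil a (\<lambda>x. x) l) \<or> invertible_op (pencil c d l)" for l
      proof (cases "l \<in> spectrum A")
        case True
        have "z = 1/2 * (l + (2 * z - l))" by simp
        then have "2 * z - l \<notin> spectrum A" using none True by blast
        \<comment> \<open>With \<open>d = -1\<close> the term \<open>- l d\<close> adds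
          \<open>l\<close>, so the second pencil is \<open>b\<close> shifted by
          \<open>2 z - l\<close>, the only partner of \<open>l\<close> whose mean with it is
          \<open>z\<close>.\<close>
        moreover have "pencil c d l = pencil b (\<lambda>x. x) (2 * z - l)"
          by (rule ext) (simp add: pencil_def c_def d_def scaleC_scaleC
              complex_vector.scale_left_diff_distrib)
        ultimately show ?thesis using inv_b by simp
      qed (use inv_a in blast)
      then have "invertible_op (\<lambda>x. a (d x) - c x)"
        by (rule commuting_pencils_invertible[OF a(1) c d comm])
      \<comment> \<open>Here \<open>a d - c\<close> is \<open>-(a + b - 2 z)\<close>, and the factor
        \<open>-1/2\<close> turns it into \<open>T - z\<close>.\<close>
      from invertible_op_scale[OF this, of "-1/2"]
      have "invertible_op (\<lambda>x. (-1/2) *\<^sub>C (a (d x) - c x))" by simp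
      moreover have "(-1/2) *\<^sub>C (a (d x) - c x) = T x - z *\<^sub>C x" for x
        by (simp add: T_def c_def d_def bounded_clinear_minus[OF a(1)] scaleC_one scaleC_scaleC
            complex_vector.scale_right_diff_distrib scaleC_add_right)
      ultimately have "invertible_op (\<lambda>x. T x - z *\<^sub>C x)" by simp
      from not_in_spectrum_on_fixed_space[OF F(1) TF this] z show False by blast
    qed
    ultimately show ?thesis unfolding S op by blast
  qed

  show "spectrum_on (sym_tensor_space tensor) (sym_tensor_op tensor A A) =
    {l * m |l m. l \<in> spectrum A \<and> m \<in> spectrum A}"
  proof -
    define T where "T x = a (b x)" for x
    have T: "bounded_clinear T" "\<And>u v. T (tensor u v) = tensor (A u) (A v)"
      unfolding T_def[abs_def] by (rule comp[OF a(1) b(1)]) (simp add: a(2) b(2))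
    have TF: "T (F x) = F (T x)" for x
      by (simp add: T_def Fa Fb ab)
    define T' where "T' x = b' (a' x)" for x
    have adj: "adjoint_pair T T'"
      unfolding T_def[abs_def] T'_def[abs_def] by (rule adjoint_pair_compose[OF a' b'])
    then have T': "bounded_clinear T'" "\<And>u v. T' (tensor u v) = tensor (A' u) (A' v)"
      by (simp_all add: adjoint_pair_def T'_def a'_tensor b'_tensor)
    have op: "sym_tensor_op tensor A A = restrict T {x. F x = x}"
    proof -
      have "(1/2) *\<^sub>C (T x + T x) = T x" for x
        using scaleC_add_left[of "1/2" "1/2" "T x"] by (simp add: scaleC_add_right scaleC_one)
      then show ?thesis
        unfolding sym_tensor_op_def S tensor_op_eqI[OF tensor T] by simp
    qed
    have "z \<in> spectrum_on {x. F x = x} (restrict T {x. F x = x})"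
      if lm: "l \<in> spectrum A" "m \<in> spectrum A" "z = l * m" for z l m
    proof -
      obtain l' m' where l': "l' * m' = l * m" and
        "approx_eigenvalue A l' \<and> approx_eigenvalue A m' \<or>
         approx_eigenvalue A' (cnj l') \<and> approx_eigenvalue A' (cnj m')"
        using spectrum_pair_product[OF A' lm(1,2)] by blast
      then show ?thesis
      proof (elim disjE conjE)
        assume ap: "approx_eigenvalue A l'" "approx_eigenvalue A m'"
        have "\<exists>w. F w = w \<and> norm w \<ge> 1 \<and> norm (T w - z *\<^sub>C w) < e" if "e > 0" for e
          using symmetric_approx_eigenvector_product[OF tensor A T ap that] FS
          unfolding l' lm(3) by metis
        then show ?thesis using in_spectrum_on_fixed_space[OF F(1) TF adj] by blast
      next
        assume ap: "approx_eigenvalue A' (cnj l')" "approx_eigenvalue A' (cnj m')"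
        have z: "cnj z = cnj l' * cnj m'" by (simp add: lm(3) flip: l')
        have "\<exists>w. F w = w \<and> norm w \<ge> 1 \<and> norm (T' w - cnj z *\<^sub>C w) < e" if "e > 0" for e
          using symmetric_approx_eigenvector_product[OF tensor bA' T' ap that] FS
          unfolding z by metis
        then show ?thesis using in_spectrum_on_fixed_space[OF F(1) TF adj] by blast
      qed
    qed
    moreover have "\<exists>l m. z = l * m \<and> l \<in> spectrum A \<and> m \<in> spectrum A"
      if z: "z \<in> spectrum_on {x. F x = x} (restrict T {x. F x = x})" for z
    proof (rule ccontr)
      assume none: "\<nexists>l m. z = l * m \<and> l \<in> spectrum A \<and> m \<in> spectrum A"
      define c :: "'k \<Rightarrow> 'k" where "c x = z *\<^sub>C x" for x
      have c: "bounded_clinear c"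
        unfolding c_def[abs_def] by (intro bounded_clinear_scale bounded_clinear_id)
      have comm: "a (c x) = c (a x)" "a (b x) = b (a x)" "c (b x) = b (c x)" for x
        by (simp_all add: c_def ab bounded_clinear_scaleC[OF a(1)] bounded_clinear_scaleC[OF b(1)])
      have "invertible_op (pencil a (\<lambda>x. x) l) \<or> invertible_op (pencil c b l)" for l
      proof (cases "l \<in> spectrum A")
        case True
        show ?thesis
        proof (cases "l = 0")
          case l0: True
          \<comment> \<open>If \<open>z\<close> were 0, it would be the product of the spectral
            point 0 with itself. At \<open>l = 0\<close> the second pencil is the nonzero multiple
            \<open>z\<close> of the identity.\<close>
          then have "z \<noteq> 0" using none True by auto
          have "invertible_op (\<lambda>x::'k. x)"
            unfolding invertible_op_def using bounded_clinear_id(2) by blast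
          from invertible_op_scale[OF this \<open>z \<noteq> 0\<close>] have "invertible_op (pencil c b l)"
            by (simp add: pencil_def[abs_def] c_def l0)
          then show ?thesis ..
        next
          case False
          then have "z = l * (z / l)" by simp
          then have "z / l \<notin> spectrum A" using none True by blast
          \<comment> \<open>For \<open>l\<close> nonzero, \<open>z - l b = - l (b - z / l)\<close>,
            so invertibility of the pencil is that of \<open>b - z / l\<close>.\<close>
          from invertible_op_scale[OF inv_b[OF this], of "- l"] False
          have "invertible_op (\<lambda>x. (- l) *\<^sub>C pencil b (\<lambda>x. x) (z / l) x)" by simp
          moreover have "(- l) *\<^sub>C pencil b (\<lambda>x. x) (z / l) x = pencil c b l x" for x
            using False by (simp add: pencil_def c_def scaleC_scaleC
                complex_vector.scale_right_diff_distrib)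
          ultimately show ?thesis by simp
        qed
      qed (use inv_a in blast)
      then have "invertible_op (\<lambda>x. a (b x) - c x)"
        by (rule commuting_pencils_invertible[OF a(1) c b(1) comm])
      then have "invertible_op (\<lambda>x. T x - z *\<^sub>C x)" by (simp add: T_def c_def)
      from not_in_spectrum_on_fixed_space[OF F(1) TF this] z show False by blast
    qed
    ultimately show ?thesis unfolding S op by blast
  qed
qed

end
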